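(* Let $N\ge 2$, let $A=\{x\in\mathbb{R}^N : a<|x|<b\}$ with $0<a<b<\infty$, let $p>1$, let $m$ be a positive integer, and let $v_p$ be a radial solution with $m$ nodal zones of $$-\Delta v=|v|^{p-1}v\ \text{ in } A,\qquad v=0\ \text{ on }\partial A.$$ Then the Morse index of $v_p$ is strictly greater than $(m-1)(N+1)$.
   Context: A radial solution has $m$ nodal zones if the set $\{x\in A: v(x)\neq 0\}$ has exactly $m$ connected components. The Morse index of $v_p$ is the number of negative eigenvalues, counted with multiplicity, of the operator $-\Delta-p|v_p|^{p-1}$ in $A$ with zero Dirichlet boundary conditions. *)

theory Defs
  imports "HOL-Analysis.Analysis" "HOL-Library.Extended_Nat"
begin

definition annulus :: "real \<Rightarrow> real \<Rightarrow> 'a::euclidean_space set" where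
  "annulus a b = {x. a < norm x \<and> norm x < b}"

(* Intended for open S: two continuous Frechet derivatives in S, no condition on the boundary. *)
definition C2_on :: "'a::euclidean_space set \<Rightarrow> ('a \<Rightarrow> real) \<Rightarrow> bool" where
  "C2_on S f \<longleftrightarrow>
    (\<exists>(f' :: 'a \<Rightarrow> 'a \<Rightarrow>\<^sub>L real) (f'' :: 'a \<Rightarrow> 'a \<Rightarrow>\<^sub>L 'a \<Rightarrow>\<^sub>L real).
      (\<forall>x\<in>S. (f has_derivative blinfun_apply (f' x)) (at x)) \<and>
      (\<forall>x\<in>S. (f' has_derivative blinfun_apply (f'' x)) (at x)) \<and>
      continuous_on S f'')"

definition partial_deriv :: "'a::euclidean_space \<Rightarrow> ('a \<Rightarrow> real) \<Rightarrow> 'a \<Rightarrow> real" where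
  "partial_deriv i f x = deriv (\<lambda>t. f (x + t *\<^sub>R i)) 0"

definition laplacian :: "('a::euclidean_space \<Rightarrow> real) \<Rightarrow> 'a \<Rightarrow> real" where
  "laplacian f x = (\<Sum>i\<in>Basis. partial_deriv i (partial_deriv i f) x)"

definition radial_on :: "'a::euclidean_space set \<Rightarrow> ('a \<Rightarrow> real) \<Rightarrow> bool" where
  "radial_on S v \<longleftrightarrow> (\<exists>u. \<forall>x\<in>S. v x = u (norm x))"

(* Classical solutions of -Laplace v = |v|^(p-1) v in A, v = 0 on the boundary of A. *)
definition lane_emden_solution :: "'a::euclidean_space set \<Rightarrow> real \<Rightarrow> ('a \<Rightarrow> real) \<Rightarrow> bool" where
  "lane_emden_solution A p v \<longleftrightarrow>
    C2_on A v \<and> continuous_on (closure A) v \<and>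
    (\<forall>x\<in>A. - laplacian v x = \<bar>v x\<bar> powr (p - 1) * v x) \<and>
    (\<forall>x\<in>frontier A. v x = 0)"

(* m is meant to be positive: card is 0 also when there are infinitely many components. *)
definition has_nodal_zones :: "'a::euclidean_space set \<Rightarrow> ('a \<Rightarrow> real) \<Rightarrow> nat \<Rightarrow> bool" where
  "has_nodal_zones A v m \<longleftrightarrow> card (components {x\<in>A. v x \<noteq> 0}) = m"

(* All \<phi> with -Laplace \<phi> - p |v|^(p-1) \<phi> = \<mu> \<phi> in A and \<phi> = 0 on the boundary of A, for
   bounded A.  A function that is continuous on the closure of A and zero on the frontier is
   represented by its extension by zero to the whole space, which is bounded and continuous;
   this makes the eigenspace a subset of a real vector space type. *)
definition eigenspace :: "'a::euclidean_space set \<Rightarrow> real \<Rightarrow> ('a \<Rightarrow> real) \<Rightarrow> real \<Rightarrow> ('a \<Rightarrow>\<^sub>C real) set" where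
  "eigenspace A p v \<mu> =
    {\<phi>. C2_on A (apply_bcontfun \<phi>) \<and>
        (\<forall>x\<in>A. - laplacian (apply_bcontfun \<phi>) x
                - p * \<bar>v x\<bar> powr (p - 1) * apply_bcontfun \<phi> x = \<mu> * apply_bcontfun \<phi> x) \<and>
        (\<forall>x. x \<notin> A \<longrightarrow> apply_bcontfun \<phi> x = 0)}"

(* Dimension with value \<infinity> for infinite-dimensional spaces, where the library's dim
   gives 0. *)
definition edim :: "'b::real_vector set \<Rightarrow> enat" where
  "edim V = (SUP B\<in>{B. B \<subseteq> V \<and> finite B \<and> independent B}. enat (card B))"

lemma edim_eq_dim:
  assumes "finite B" "B \<subseteq> V" "independent B" "V \<subseteq> span B"
  shows "edim V = enat (dim V)"
proof -
  have d: "dim V = card B"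
    using assms by (intro dim_unique[of B]) auto
  show ?thesis
    unfolding edim_def d
  proof (rule antisym)
    show "(SUP C\<in>{C. C \<subseteq> V \<and> finite C \<and> independent C}. enat (card C)) \<le> enat (card B)"
      using assms independent_span_bound[of B] by (intro SUP_least) auto
    show "enat (card B) \<le> (SUP C\<in>{C. C \<subseteq> V \<and> finite C \<and> independent C}. enat (card C))"
      using assms by (intro SUP_upper) auto
  qed
qed

(* The sum over all \<mu> < 0 of the multiplicity of \<mu>, which is 0 unless \<mu> is an eigenvalue; the
   sum of the nonnegative extended terms is the supremum of its finite partial sums. *)
definition morse_index :: "'a::euclidean_space set \<Rightarrow> real \<Rightarrow> ('a \<Rightarrow> real) \<Rightarrow> enat" where
  "morse_index A p v =
    (SUP L\<in>{L. finite L \<and> L \<subseteq> {..<0}}. \<Sum>\<mu>\<in>L. edim (eigenspace A p v \<mu>))"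

end

theory Submission
  imports Defs
begin

text \<open>
Write \<^term>\<open>N\<close> for the dimension, \<open>v x = u (norm x)\<close>, and \<open>q = p * \<bar>u\<bar> powr (p - 1)\<close>. Separation of
variables supplies enough negative eigenvalues from the two lowest families of spherical harmonics:
the radial functions \<open>h (norm x)\<close> and the functions \<open>h (norm x) * (x \<bullet> d)\<close>. Both lead to the
same one-dimensional problem
\<open>- (t^n h')' - t^n q h = \<mu> t^n h\<close>, \<open>h a = h b = 0\<close>,
with \<open>n = N - 1\<close> in the radial case and \<open>n = N + 1\<close> in the angular one: multiplying by a linear
function acts on radial factors as a shift of the dimension by two. Each eigenvalue of the first
kind contributes dimension 1 to the eigenspace and each eigenvalue of the second kind contributes
dimension \<^term>\<open>N\<close>; even and odd functions do not interfere, so contributions to the same \<open>\<mu>\<close> add up.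
It is enough to find \<^term>\<open>m\<close> negative eigenvalues in the radial case and \<open>m - 1\<close> in the angular one,
since \<open>m + N * (m - 1) > (m - 1) * (N + 1)\<close>.

By oscillation theory a one-dimensional problem has at least \<^term>\<open>k\<close> negative eigenvalues as soon as all
solutions of its equation for \<open>\<mu> = 0\<close> have \<^term>\<open>k\<close> zeros in the open interval (theorem
\<open>sl_negative_eigenvalues\<close>). This is proved by shooting with the Pruefer angle: its value at \<^term>\<open>b\<close> is
continuous in \<open>\<mu>\<close>, is at most \<open>pi / 2\<close> for very negative \<open>\<mu>\<close>, and exceeds \<open>k * pi\<close> for
\<open>\<mu> = 0\<close>, so it takes the values \<open>pi, ..., k * pi\<close> at negative \<open>\<mu>\<close>.

The zeros come from comparison with \<^term>\<open>u\<close> itself. The profile \<^term>\<open>u\<close> solves the radial equation with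
\<open>\<bar>u\<bar> powr (p - 1)\<close> in place of the larger \<open>q\<close>, so by Sturm comparison every radial solution
vanishes inside each of the \<^term>\<open>m\<close> nodal intervals (\<open>lane_emden_radial_zeros\<close>). The partial derivatives of
\<^term>\<open>v\<close> solve the linearised equation, which means that \<open>u' / t\<close> solves the angular one. It vanishes
at a critical point of \<^term>\<open>u\<close> in each nodal interval, and a Wronskian argument puts a zero of every
angular solution between consecutive ones, which gives \<open>m - 1\<close> zeros (\<open>lane_emden_angular_zeros\<close>).
\<close>

section \<open>Scalar Lipschitz differential equations\<close>

lemma clamped_in_bcontfun:
  fixes g :: "real \<Rightarrow> real"
  assumes "a \<le> b" and g: "continuous_on {a..b} g"
  shows "(\<lambda>t. g (max a (min b t))) \<in> bcontfun"
proof -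
  have c: "continuous_on UNIV (\<lambda>t. g (max a (min b t)))"
    by (rule continuous_on_compose2[OF g]) (use assms in \<open>auto intro!: continuous_intros\<close>)
  have "bounded (g ` {a..b})"
    using g by (intro compact_imp_bounded compact_continuous_image) auto
  then have "bounded (range (\<lambda>t. g (max a (min b t))))"
    by (rule bounded_subset) (use assms in auto)
  with c show ?thesis by (simp add: bcontfun_def)
qed

lemma continuous_on_interval_abs_bound:
  fixes g :: "real \<Rightarrow> real"
  assumes "continuous_on {a..b} g"
  obtains M where "M \<ge> 0" "\<And>t. t \<in> {a..b} \<Longrightarrow> \<bar>g t\<bar> \<le> M"
proof -
  have "bounded (g ` {a..b})" using assms by (intro compact_imp_bounded compact_continuous_image) auto
  then obtain M where "M > 0" "\<forall>t\<in>{a..b}. \<bar>g t\<bar> \<le> M" by (auto simp: bounded_pos)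
  then show ?thesis using that[of M] by auto
qed

text \<open>The substitution \<open>\<theta> t = exp (C * t) * y t\<close> with \<open>C > 2 * K\<close> turns the integral equation into a fixed
point equation whose operator is a contraction with constant \<open>1 / 2\<close> on the whole
interval. Freezing functions outside the interval lets the
operator act on the complete space of bounded continuous functions on the line.\<close>
lemma lipschitz_ode_solution_exists:
  fixes F :: "real \<Rightarrow> real \<Rightarrow> real"
  assumes ab: "a \<le> b"
    and cont: "continuous_on ({a..b} \<times> UNIV) (\<lambda>(t, x). F t x)"
    and K: "K \<ge> 0" and lip: "\<And>t x y. t \<in> {a..b} \<Longrightarrow> \<bar>F t x - F t y\<bar> \<le> K * \<bar>x - y\<bar>"
  shows "\<exists>\<theta>. \<theta> a = \<alpha> \<and> continuous_on {a..b} \<theta> \<and>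
    (\<forall>t\<in>{a<..<b}. (\<theta> has_real_derivative F t (\<theta> t)) (at t))"
proof -
  define C where "C = 2 * K + 1"
  have C: "C > 0" using K by (simp add: C_def)
  define I where "I = (\<lambda>(y::real \<Rightarrow>\<^sub>C real) s. F s (exp (C * s) * apply_bcontfun y s))"
  define G where "G = (\<lambda>y t. exp (- (C * t)) * (\<alpha> + integral {a..t} (I y)))"
  define T where "T = (\<lambda>y. Bcontfun (\<lambda>t. G y (max a (min b t))))"
  have cI: "continuous_on {a..b} (I y)" for y
  proof -
    have "continuous_on {a..b} (\<lambda>s. (\<lambda>(t, x). F t x) (s, exp (C * s) * apply_bcontfun y s))"
      by (rule continuous_on_compose2[OF cont]) (auto intro!: continuous_intros)
    then show ?thesis by (simp add: I_def)
  qed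
  have intI: "I y integrable_on {a..t}" if "t \<le> b" for y t
    using cI[of y] that by (intro integrable_continuous_interval continuous_on_subset[OF cI]) auto
  have cG: "continuous_on {a..b} (G y)" for y
    unfolding G_def
    by (intro continuous_intros indefinite_integral_continuous_1 integrable_continuous_interval cI)
  have T: "apply_bcontfun (T y) t = G y (max a (min b t))" for y t
    unfolding T_def by (subst Bcontfun_inverse) (use clamped_in_bcontfun[OF ab cG] in auto)
  have contr: "\<bar>G y t - G z t\<bar> \<le> 1/2 * dist y z" if t: "t \<in> {a..b}" for y z t
  proof -
    let ?d = "dist y z"
    have "((\<lambda>s. K * ?d * exp (C * s)) has_integral (K * ?d / C * exp (C * t) - K * ?d / C * exp (C * a))) {a..t}"
      using t C by (intro fundamental_theorem_of_calculus)
        (auto simp: has_real_derivative_iff_has_vector_derivative[symmetric] intro!: derivative_eq_intros)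
    note hi = this
    have "\<bar>integral {a..t} (\<lambda>s. I y s - I z s)\<bar> \<le> integral {a..t} (\<lambda>s. K * ?d * exp (C * s))"
      unfolding real_norm_def[symmetric]
    proof (rule integral_norm_bound_integral)
      show "(\<lambda>s. I y s - I z s) integrable_on {a..t}"
        using intI[of t] t by (intro integrable_diff) auto
      show "(\<lambda>s. K * ?d * exp (C * s)) integrable_on {a..t}" using hi by blast
      fix s assume s: "s \<in> {a..t}"
      have "\<bar>I y s - I z s\<bar> \<le> K * \<bar>exp (C * s) * apply_bcontfun y s - exp (C * s) * apply_bcontfun z s\<bar>"
        unfolding I_def using s t by (intro lip) auto
      also have "\<dots> = K * (exp (C * s) * dist (apply_bcontfun y s) (apply_bcontfun z s))"
        by (simp add: dist_real_def abs_mult flip: right_diff_distrib)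
      also have "\<dots> \<le> K * (exp (C * s) * ?d)"
        using K by (intro mult_left_mono dist_bounded) auto
      finally show "norm (I y s - I z s) \<le> K * ?d * exp (C * s)" by (simp add: mult_ac)
    qed
    also have "\<dots> = K * ?d / C * exp (C * t) - K * ?d / C * exp (C * a)"
      using hi by (rule integral_unique)
    also have "\<dots> \<le> K * ?d / C * exp (C * t)" using K C by simp
    finally have 1: "\<bar>integral {a..t} (\<lambda>s. I y s - I z s)\<bar> \<le> K * ?d / C * exp (C * t)" .
    have "\<bar>G y t - G z t\<bar> = exp (- (C * t)) * \<bar>integral {a..t} (\<lambda>s. I y s - I z s)\<bar>"
      unfolding G_def using intI[of t] t
      by (subst integral_diff) (auto simp: abs_mult right_diff_distrib[symmetric])
    also have "\<dots> \<le> exp (- (C * t)) * (K * ?d / C * exp (C * t))"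
      using 1 by (intro mult_left_mono) auto
    also have "\<dots> = K / C * ?d" by (simp add: exp_minus field_simps)
    also have "\<dots> \<le> 1/2 * ?d"
      using K C by (intro mult_right_mono) (auto simp: C_def field_simps)
    finally show ?thesis .
  qed
  have "dist (T y) (T z) \<le> 1/2 * dist y z" for y z
  proof (rule dist_bound)
    fix t
    have "max a (min b t) \<in> {a..b}" using ab by auto
    from contr[OF this] show "dist (apply_bcontfun (T y) t) (apply_bcontfun (T z) t) \<le> 1/2 * dist y z"
      by (simp add: T dist_real_def)
  qed
  then have "\<exists>!y. T y = y" by (intro banach_fix_type[of "1/2"]) auto
  then obtain y where y: "T y = y" by blast
  define \<theta> where "\<theta> t = exp (C * t) * apply_bcontfun y t" for t
  have \<theta>: "\<theta> t = \<alpha> + integral {a..t} (I y)" if "t \<in> {a..b}" for t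
  proof -
    have "apply_bcontfun y t = G y t" using T[of y t] y that by (simp add: max_absorb2 min_absorb2)
    then show ?thesis by (simp add: \<theta>_def G_def exp_minus field_simps)
  qed
  have I\<theta>: "I y t = F t (\<theta> t)" for t by (simp add: I_def \<theta>_def)
  show ?thesis
  proof (intro exI[of _ \<theta>] conjI ballI)
    show "\<theta> a = \<alpha>" using \<theta>[of a] ab by simp
    show "continuous_on {a..b} \<theta>" unfolding \<theta>_def by (auto intro!: continuous_intros)
    fix t assume t: "t \<in> {a<..<b}"
    have "((\<lambda>t. \<alpha> + integral {a..t} (I y)) has_real_derivative I y t) (at t within {a..b})"
      using t cI by (auto intro!: derivative_eq_intros integral_has_real_derivative)
    then have "(\<theta> has_real_derivative I y t) (at t within {a..b})"
      by (rule has_field_derivative_transform_within[where d = 1]) (use \<theta> t in auto)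
    then have "(\<theta> has_real_derivative I y t) (at t within {a<..<b})"
      by (rule has_field_derivative_subset) auto
    then show "(\<theta> has_real_derivative F t (\<theta> t)) (at t)"
      using t by (simp add: I\<theta> at_within_open[of t "{a<..<b}"])
  qed
qed

text \<open>Subsolutions stay below supersolutions. If \<^term>\<open>f\<close> exceeded \<^term>\<open>g\<close> at \<^term>\<open>t\<close>, then after the last time
before \<^term>\<open>t\<close> with \<open>f \<le> g\<close> the quantity \<open>exp (- K * r) * (f r - g r)\<close> could not increase, by the
Lipschitz condition.\<close>
lemma ode_comparison:
  fixes f g :: "real \<Rightarrow> real" and F :: "real \<Rightarrow> real \<Rightarrow> real"
  assumes lip: "\<And>t x y. t \<in> {a..b} \<Longrightarrow> \<bar>F t x - F t y\<bar> \<le> K * \<bar>x - y\<bar>"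
    and cf: "continuous_on {a..b} f" and cg: "continuous_on {a..b} g"
    and df: "\<And>t. t \<in> {a<..<b} \<Longrightarrow> (f has_real_derivative f' t) (at t)"
    and dg: "\<And>t. t \<in> {a<..<b} \<Longrightarrow> (g has_real_derivative g' t) (at t)"
    and sub: "\<And>t. t \<in> {a<..<b} \<Longrightarrow> f' t \<le> F t (f t)"
    and super: "\<And>t. t \<in> {a<..<b} \<Longrightarrow> F t (g t) \<le> g' t"
    and init: "f a \<le> g a" and t: "t \<in> {a..b}"
  shows "f t \<le> g t"
proof (rule ccontr)
  assume neg: "\<not> f t \<le> g t"
  let ?S = "{s\<in>{a..t}. f s \<le> g s}"
  have c: "continuous_on {a..t} f" "continuous_on {a..t} g"
    using t by (auto intro: continuous_on_subset[OF cf] continuous_on_subset[OF cg])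
  have "closed ?S" using c by (intro continuous_on_closed_Collect_le) auto
  moreover have "a \<in> ?S" using init t by auto
  moreover have bdd: "bdd_above ?S" by (rule bdd_aboveI[of _ t]) auto
  ultimately have s: "Sup ?S \<in> ?S" by (intro closed_contains_Sup) auto
  define s where "s = Sup ?S"
  have s1: "a \<le> s" "s < t" "f s \<le> g s" using s neg unfolding s_def by (auto simp: less_le)
  have above: "f r > g r" if "s < r" "r \<le> t" for r
    using cSup_upper[of r ?S] bdd that s1 unfolding s_def[symmetric] by force
  let ?h = "\<lambda>r. exp (- K * r) * (f r - g r)"
  have "?h t \<le> ?h s"
  proof (rule DERIV_nonpos_imp_decreasing_open[of s t])
    show "continuous_on {s..t} ?h"
      using s1 by (intro continuous_intros continuous_on_subset[OF c(1)] continuous_on_subset[OF c(2)]) auto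
    fix r assume r: "s < r" "r < t"
    then have r': "r \<in> {a<..<b}" using s1 t by auto
    have "(?h has_real_derivative exp (- K * r) * (f' r - g' r - K * (f r - g r))) (at r)"
      by (rule derivative_eq_intros refl df[OF r'] dg[OF r'])+ (simp add: algebra_simps)
    moreover have "f' r - g' r - K * (f r - g r) \<le> 0"
      using sub[OF r'] super[OF r'] lip[of r "f r" "g r"] above[of r] r r' by (simp add: abs_le_iff)
    ultimately show "\<exists>y. (?h has_real_derivative y) (at r) \<and> y \<le> 0"
      by (intro exI[of _ "exp (- K * r) * (f' r - g' r - K * (f r - g r))"])
        (auto intro: mult_nonneg_nonpos)
  qed (use s1 in auto)
  also have "\<dots> \<le> 0" using s1 by (intro mult_nonneg_nonpos) auto
  finally show False using neg by (simp add: mult_le_0_iff)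
qed

section \<open>Sturm-Liouville solutions and their Pruefer angle\<close>

text \<open>Written as a first order system for \<open>\<phi>\<close> and its flux \<open>\<psi> = t^n \<phi>'\<close>, the equation is
\<open>(t^n \<phi>')' + t^n q \<phi> = 0\<close>, the radial form of \<open>\<Delta>\<phi> + q \<phi> = 0\<close> in dimension \<open>n + 1\<close>. The flux is
continuous up to the end points, so boundary terms of Wronskians make sense there.\<close>
definition sl_solution :: "nat \<Rightarrow> (real \<Rightarrow> real) \<Rightarrow> real \<Rightarrow> real \<Rightarrow> (real \<Rightarrow> real) \<Rightarrow> (real \<Rightarrow> real) \<Rightarrow> bool" where
  "sl_solution n q a b \<phi> \<psi> \<longleftrightarrow>
    continuous_on {a..b} \<phi> \<and> continuous_on {a..b} \<psi> \<and>
    (\<forall>t\<in>{a<..<b}. (\<phi> has_real_derivative \<psi> t / t ^ n) (at t) \<and>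
                   (\<psi> has_real_derivative - (t ^ n * q t * \<phi> t)) (at t))"

text \<open>The angle \<open>\<theta>\<close> in polar coordinates \<open>\<phi> = \<rho> sin \<theta>\<close>, \<open>\<psi> = \<rho> cos \<theta>\<close> satisfies a scalar equation
that does not involve \<open>\<rho>\<close>; this is its right-hand side.\<close>
definition prufer_field :: "nat \<Rightarrow> (real \<Rightarrow> real) \<Rightarrow> real \<Rightarrow> real \<Rightarrow> real" where
  "prufer_field n q t x = (cos x)\<^sup>2 / t ^ n + t ^ n * q t * (sin x)\<^sup>2"

definition prufer_angle :: "nat \<Rightarrow> (real \<Rightarrow> real) \<Rightarrow> real \<Rightarrow> real \<Rightarrow> (real \<Rightarrow> real) \<Rightarrow> bool" where
  "prufer_angle n q a b \<theta> \<longleftrightarrow>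
    continuous_on {a..b} \<theta> \<and>
    (\<forall>t\<in>{a<..<b}. (\<theta> has_real_derivative prufer_field n q t (\<theta> t)) (at t))"

lemma abs_sin_squared_diff_le: "\<bar>(sin x)\<^sup>2 - (sin y)\<^sup>2\<bar> \<le> \<bar>x - y\<bar>" for x y :: real
proof -
  have "(sin x)\<^sup>2 - (sin y)\<^sup>2 = sin (x + y) * sin (x - y)"
  proof -
    have "sin (x + y) * sin (x - y) = (sin x)\<^sup>2 * (cos y)\<^sup>2 - (cos x)\<^sup>2 * (sin y)\<^sup>2"
      by (simp add: sin_add sin_diff power2_eq_square algebra_simps)
    then show ?thesis by (simp add: cos_squared_eq algebra_simps)
  qed
  also have "\<bar>\<dots>\<bar> \<le> 1 * \<bar>x - y\<bar>"
    unfolding abs_mult by (intro mult_mono abs_sin_x_le_abs_x) auto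
  finally show ?thesis by simp
qed

lemma prufer_field_lipschitz:
  assumes "0 < a" "t \<in> {a..b}" "\<bar>q t\<bar> \<le> M"
  shows "\<bar>prufer_field n q t x - prufer_field n q t y\<bar> \<le> (1 / a ^ n + b ^ n * M) * \<bar>x - y\<bar>"
proof -
  have "prufer_field n q t x - prufer_field n q t y
      = (t ^ n * q t - 1 / t ^ n) * ((sin x)\<^sup>2 - (sin y)\<^sup>2)"
    by (simp add: prufer_field_def cos_squared_eq diff_divide_distrib algebra_simps)
  also have "\<bar>\<dots>\<bar> \<le> (1 / a ^ n + b ^ n * M) * \<bar>x - y\<bar>"
    unfolding abs_mult
  proof (intro mult_mono abs_sin_squared_diff_le)
    have "\<bar>t ^ n * q t - 1 / t ^ n\<bar> \<le> \<bar>t ^ n * q t\<bar> + \<bar>1 / t ^ n\<bar>" by (rule abs_triangle_ineq4)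
    also have "\<bar>1 / t ^ n\<bar> \<le> 1 / a ^ n"
      using assms by (auto intro!: divide_left_mono power_mono mult_pos_pos)
    also have "\<bar>t ^ n * q t\<bar> \<le> b ^ n * M"
      using assms unfolding abs_mult by (intro mult_mono) (auto intro!: power_mono simp: power_abs)
    finally show "\<bar>t ^ n * q t - 1 / t ^ n\<bar> \<le> 1 / a ^ n + b ^ n * M" by simp
    have "0 \<le> M" using assms(3) by linarith
    then show "0 \<le> 1 / a ^ n + b ^ n * M" using assms by auto
  qed auto
  finally show ?thesis .
qed

lemma prufer_angle_exists:
  assumes "0 < a" "a \<le> b" and q: "continuous_on {a..b} q"
  shows "\<exists>\<theta>. \<theta> a = 0 \<and> prufer_angle n q a b \<theta>"
proof -
  obtain M where "M \<ge> 0" and M: "\<And>t. t \<in> {a..b} \<Longrightarrow> \<bar>q t\<bar> \<le> M"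
    using continuous_on_interval_abs_bound[OF q] by blast
  define K where "K = 1 / a ^ n + b ^ n * M"
  have K: "K \<ge> 0" using assms \<open>M \<ge> 0\<close> by (simp add: K_def)
  have lip: "\<bar>prufer_field n q t x - prufer_field n q t y\<bar> \<le> K * \<bar>x - y\<bar>" if "t \<in> {a..b}" for t x y
    unfolding K_def using that M by (intro prufer_field_lipschitz \<open>0 < a\<close>)
  have "continuous_on ({a..b} \<times> UNIV) (\<lambda>z. q (fst z))"
    by (rule continuous_on_compose2[OF q]) (auto intro!: continuous_intros)
  then have "continuous_on ({a..b} \<times> UNIV) (\<lambda>(t, x). prufer_field n q t x)"
    unfolding prufer_field_def split_beta using assms by (intro continuous_intros) auto
  from lipschitz_ode_solution_exists[where \<alpha> = 0, OF \<open>a \<le> b\<close> this K lip]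
  show ?thesis by (simp add: prufer_angle_def)
qed

text \<open>Conversely, every solution of the angle equation comes from a solution of the linear system: the
radius has to satisfy the linear equation \<open>\<rho>' = \<rho> (1 / t^n - t^n q) sin \<theta> cos \<theta>\<close> and is an
exponential of an integral.\<close>
lemma prufer_angle_polar:
  assumes "0 < a" "a \<le> b" and q: "continuous_on {a..b} q" and \<theta>: "prufer_angle n q a b \<theta>"
  obtains \<rho> where "\<And>t. \<rho> t > 0" "sl_solution n q a b (\<lambda>t. \<rho> t * sin (\<theta> t)) (\<lambda>t. \<rho> t * cos (\<theta> t))"
proof -
  have c\<theta>: "continuous_on {a..b} \<theta>" and
    d\<theta>: "\<And>t. t \<in> {a<..<b} \<Longrightarrow> (\<theta> has_real_derivative prufer_field n q t (\<theta> t)) (at t)"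
    using \<theta> by (auto simp: prufer_angle_def)
  define k where "k t = (1 / t ^ n - t ^ n * q t) * (sin (\<theta> t) * cos (\<theta> t))" for t
  have ck: "continuous_on {a..b} k"
    unfolding k_def using assms by (intro continuous_intros q c\<theta>) auto
  define \<rho> where "\<rho> t = exp (integral {a..t} k)" for t
  have c\<rho>: "continuous_on {a..b} \<rho>"
    unfolding \<rho>_def
    by (intro continuous_intros indefinite_integral_continuous_1 integrable_continuous_interval ck)
  have d\<rho>: "(\<rho> has_real_derivative \<rho> t * k t) (at t)" if t: "t \<in> {a<..<b}" for t
  proof -
    have "((\<lambda>t. integral {a..t} k) has_real_derivative k t) (at t within {a..b})"
      using t by (intro integral_has_real_derivative ck) auto
    then have "((\<lambda>t. integral {a..t} k) has_real_derivative k t) (at t within {a<..<b})"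
      by (rule has_field_derivative_subset) auto
    then have "((\<lambda>t. integral {a..t} k) has_real_derivative k t) (at t)"
      using t by (simp add: at_within_open[of t "{a<..<b}"])
    then show ?thesis unfolding \<rho>_def by (auto intro!: derivative_eq_intros)
  qed
  have "sl_solution n q a b (\<lambda>t. \<rho> t * sin (\<theta> t)) (\<lambda>t. \<rho> t * cos (\<theta> t))"
    unfolding sl_solution_def
  proof (intro conjI ballI)
    fix t assume t: "t \<in> {a<..<b}"
    define P where "P = t ^ n"
    have P: "P > 0" using t assms by (auto simp: P_def)
    have eq1: "(1 / P - P * q t) * (s * c) * s + c * (c\<^sup>2 / P + P * q t * s\<^sup>2) = c / P"
      if "s\<^sup>2 + c\<^sup>2 = 1" for s c :: real
    proof -
      have "(1 / P - P * q t) * (s * c) * s + c * (c\<^sup>2 / P + P * q t * s\<^sup>2) = c * (s\<^sup>2 + c\<^sup>2) / P"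
        using P by (simp add: field_simps power2_eq_square)
      then show ?thesis using that by simp
    qed
    have eq2: "(1 / P - P * q t) * (s * c) * c - s * (c\<^sup>2 / P + P * q t * s\<^sup>2) = - (P * q t * s)"
      if "s\<^sup>2 + c\<^sup>2 = 1" for s c :: real
    proof -
      have "(1 / P - P * q t) * (s * c) * c - s * (c\<^sup>2 / P + P * q t * s\<^sup>2) = - (P * q t * s * (s\<^sup>2 + c\<^sup>2))"
        using P by (simp add: field_simps power2_eq_square)
      then show ?thesis using that by simp
    qed
    have "((\<lambda>t. \<rho> t * sin (\<theta> t)) has_real_derivative
        \<rho> t * k t * sin (\<theta> t) + \<rho> t * (cos (\<theta> t) * prufer_field n q t (\<theta> t))) (at t)"
      by (rule derivative_eq_intros refl d\<rho>[OF t] d\<theta>[OF t])+ (simp add: algebra_simps)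
    also have "\<rho> t * k t * sin (\<theta> t) + \<rho> t * (cos (\<theta> t) * prufer_field n q t (\<theta> t))
        = \<rho> t * (cos (\<theta> t) / P)"
      unfolding eq1[OF sin_cos_squared_add[of "\<theta> t"], symmetric]
      by (simp add: k_def prufer_field_def P_def ring_distribs mult_ac)
    finally show "((\<lambda>t. \<rho> t * sin (\<theta> t)) has_real_derivative \<rho> t * cos (\<theta> t) / t ^ n) (at t)"
      by (simp add: P_def)
    have "((\<lambda>t. \<rho> t * cos (\<theta> t)) has_real_derivative
        \<rho> t * k t * cos (\<theta> t) - \<rho> t * (sin (\<theta> t) * prufer_field n q t (\<theta> t))) (at t)"
      by (rule derivative_eq_intros refl d\<rho>[OF t] d\<theta>[OF t])+ (simp add: algebra_simps)
    also have "\<rho> t * k t * cos (\<theta> t) - \<rho> t * (sin (\<theta> t) * prufer_field n q t (\<theta> t))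
        = \<rho> t * (- (P * q t * sin (\<theta> t)))"
      unfolding eq2[OF sin_cos_squared_add[of "\<theta> t"], symmetric]
      by (simp add: k_def prufer_field_def P_def ring_distribs right_diff_distrib mult_ac)
    finally show "((\<lambda>t. \<rho> t * cos (\<theta> t)) has_real_derivative - (t ^ n * q t * (\<rho> t * sin (\<theta> t)))) (at t)"
      by (simp add: P_def mult_ac)
  qed (intro continuous_intros c\<rho> c\<theta>)+
  moreover have "\<rho> t > 0" for t by (simp add: \<rho>_def)
  ultimately show ?thesis using that by blast
qed

text \<open>Multiples of \<^term>\<open>pi\<close> are passed upwards only, because the angle equation reads \<open>\<theta>' = 1 / t^n > 0\<close>
there. The exponential factor makes the conclusion strict also at the end point \<^term>\<open>b\<close>, where the
angle need not be differentiable.\<close>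
lemma prufer_angle_upcrossing:
  assumes "0 < a" and q: "continuous_on {a..b} q" and \<theta>: "prufer_angle n q a b \<theta>"
    and st: "a \<le> s" "s < t" "t \<le> b" and k: "of_int k * pi \<le> \<theta> s"
  shows "of_int k * pi < \<theta> t"
proof -
  obtain M where M: "\<And>t. t \<in> {a..b} \<Longrightarrow> \<bar>q t\<bar> \<le> M"
    using continuous_on_interval_abs_bound[OF q] by blast
  define K where "K = 1 / a ^ n + b ^ n * M"
  have lip: "\<bar>prufer_field n q r x - prufer_field n q r y\<bar> \<le> K * \<bar>x - y\<bar>" if "r \<in> {a..b}" for r x y
    unfolding K_def using that M by (intro prufer_field_lipschitz \<open>0 < a\<close>)
  have c\<theta>: "continuous_on {s..b} \<theta>" and
    d\<theta>: "\<And>t. t \<in> {a<..<b} \<Longrightarrow> (\<theta> has_real_derivative prufer_field n q t (\<theta> t)) (at t)"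
    using \<theta> st by (auto simp: prufer_angle_def intro: continuous_on_subset)
  have F0: "prufer_field n q r (of_int k * pi) = 1 / r ^ n" for r
  proof -
    have "sin (of_int k * pi) = 0" by (simp add: sin_zero_iff_int2)
    then show ?thesis by (simp add: prufer_field_def cos_squared_eq)
  qed
  have ge: "of_int k * pi \<le> \<theta> r" if r: "r \<in> {s..b}" for r
  proof (rule ode_comparison[where F = "prufer_field n q" and K = K and f = "\<lambda>_. of_int k * pi"
        and f' = "\<lambda>_. 0" and g = \<theta> and g' = "\<lambda>t. prufer_field n q t (\<theta> t)" and a = s and b = b])
    fix t assume t: "t \<in> {s<..<b}"
    show "(\<theta> has_real_derivative prufer_field n q t (\<theta> t)) (at t)" using t st by (intro d\<theta>) auto
    show "0 \<le> prufer_field n q t (of_int k * pi)" unfolding F0 using t st \<open>0 < a\<close> by simp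
  next
    fix t x y assume "t \<in> {s..b}"
    then show "\<bar>prufer_field n q t x - prufer_field n q t y\<bar> \<le> K * \<bar>x - y\<bar>" using st by (intro lip) auto
  qed (use c\<theta> k r in \<open>auto intro!: continuous_intros\<close>)
  let ?h = "\<lambda>r. exp (K * r) * (\<theta> r - of_int k * pi)"
  have "?h s < ?h t"
  proof (rule DERIV_pos_imp_increasing_open[OF \<open>s < t\<close>])
    show "continuous_on {s..t} ?h"
      using st by (intro continuous_intros continuous_on_subset[OF c\<theta>]) auto
    fix r assume r: "s < r" "r < t"
    then have r': "r \<in> {a<..<b}" using st by auto
    have "(?h has_real_derivative exp (K * r) * (prufer_field n q r (\<theta> r) + K * (\<theta> r - of_int k * pi))) (at r)"
      by (rule derivative_eq_intros refl d\<theta>[OF r'])+ (simp add: algebra_simps)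
    moreover have "\<bar>prufer_field n q r (\<theta> r) - 1 / r ^ n\<bar> \<le> K * \<bar>\<theta> r - of_int k * pi\<bar>"
      using lip[of r "\<theta> r" "of_int k * pi"] r' by (simp add: F0)
    then have "prufer_field n q r (\<theta> r) + K * (\<theta> r - of_int k * pi) \<ge> 1 / r ^ n"
      using ge[of r] r st by (simp add: abs_le_iff algebra_simps)
    then have "prufer_field n q r (\<theta> r) + K * (\<theta> r - of_int k * pi) > 0"
      by (rule less_le_trans[rotated]) (use r st \<open>0 < a\<close> in auto)
    ultimately show "\<exists>y. (?h has_real_derivative y) (at r) \<and> y > 0"
      by (intro exI[of _ "exp (K * r) * (prufer_field n q r (\<theta> r) + K * (\<theta> r - of_int k * pi))"])
        auto
  qed
  moreover have "?h s \<ge> 0" using k by auto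
  ultimately have "0 < ?h t" by (rule le_less_trans[rotated])
  then show ?thesis by (simp add: zero_less_mult_iff)
qed

text \<open>The zeros of \<open>sin \<theta>\<close> are points where \<open>\<theta>\<close> is a multiple of \<^term>\<open>pi\<close>; by
\<open>prufer_angle_upcrossing\<close> the multiples are positive and increase strictly from one zero to the next, so the
last of \<^term>\<open>k\<close> zeros has angle at least \<open>k * pi\<close>.\<close>
lemma prufer_angle_counts_zeros:
  assumes "0 < a" "a < b" and q: "continuous_on {a..b} q" and \<theta>: "prufer_angle n q a b \<theta>" "\<theta> a = 0"
    and Z: "Z \<subseteq> {a<..<b}" "finite Z" "\<And>t. t \<in> Z \<Longrightarrow> sin (\<theta> t) = 0"
  shows "real (card Z) * pi < \<theta> b"
proof -
  note up = prufer_angle_upcrossing[OF \<open>0 < a\<close> q \<theta>(1)]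
  define J where "J t = \<lfloor>\<theta> t / pi\<rfloor>" for t
  have J: "\<theta> t = of_int (J t) * pi" if tZ: "t \<in> Z" for t
    
  proof -
    obtain i :: int where "\<theta> t = of_int i * pi" using Z(3)[OF tZ] unfolding sin_zero_iff_int2 by blast
    then show ?thesis by (simp add: J_def)
  qed
  have inc: "J s < J t" if "s \<in> Z" "t \<in> Z" "s < t" for s t
  proof -
    have "of_int (J s) * pi < \<theta> t" using that Z J[of s] by (intro up[of s]) auto
    then show ?thesis using J[OF that(2)] by simp
  qed
  have "inj_on J Z" 
  proof (rule inj_onI, rule ccontr)
    fix s t assume st: "s \<in> Z" "t \<in> Z" "J s = J t" "s \<noteq> t"
    then consider "s < t" | "t < s" by linarith
    then show False using inc[of s t] inc[of t s] st by cases auto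
  qed
  have pos: "J t \<ge> 1" if "t \<in> Z" for t
  proof -
    have "a < t" "t < b" using that Z by auto
    then have "0 < of_int (J t) * pi" using up[of a t 0] J[OF that] \<theta>(2) by simp
    then show ?thesis by (simp add: zero_less_mult_iff)
  qed
  show ?thesis
  proof (cases "Z = {}")
    case True
    then show ?thesis using up[of a b 0] \<open>a < b\<close> \<theta>(2) by simp
  next
    case False
    have "\<exists>t\<in>Z. J t \<ge> int (card Z)"
    proof (rule ccontr)
      assume "\<not> (\<exists>t\<in>Z. J t \<ge> int (card Z))"
      then have "J ` Z \<subseteq> {1..int (card Z) - 1}" using pos by force
      then have "card (J ` Z) \<le> card {1..int (card Z) - 1}" by (intro card_mono) auto
      then show False using card_image[OF \<open>inj_on J Z\<close>] card_gt_0_iff[of Z] False Z(2) by simp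
    qed
    then obtain t where t: "t \<in> Z" "J t \<ge> int (card Z)" by blast
    have "of_int (int (card Z)) * pi < \<theta> b"
    proof (rule up[of t])
      show "of_int (int (card Z)) * pi \<le> \<theta> t"
        unfolding J[OF t(1)] using t(2) by (intro mult_right_mono) (simp_all only: of_int_le_iff pi_ge_zero)
    qed (use t(1) Z(1) in auto)
    then show ?thesis by simp
  qed
qed

text \<open>A Gronwall estimate obtained from \<open>ode_comparison\<close>: raising \<open>\<eta>\<close> by the exponentially growing term
compensates for the change of the potential and yields a supersolution of the equation of \<open>\<theta>\<close>.\<close>
lemma prufer_angle_parameter_continuity:
  assumes "0 < a" "a \<le> b" and K: "K \<ge> 0"
    and lip: "\<And>t x y. t \<in> {a..b} \<Longrightarrow> \<bar>prufer_field n p t x - prufer_field n p t y\<bar> \<le> K * \<bar>x - y\<bar>"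
    and \<theta>: "prufer_angle n p a b \<theta>" and \<eta>: "prufer_angle n q a b \<eta>" and init: "\<theta> a = \<eta> a"
    and pq: "\<And>t. t \<in> {a..b} \<Longrightarrow> \<bar>p t - q t\<bar> \<le> \<delta>"
  shows "\<theta> b \<le> \<eta> b + \<delta> * b ^ n * exp ((K + 1) * (b - a))"
proof (rule ode_comparison[where F = "prufer_field n p" and K = K and f = \<theta>
      and a = a and f' = "\<lambda>t. prufer_field n p t (\<theta> t)"
      and g = "\<lambda>t. \<eta> t + \<delta> * b ^ n * exp ((K + 1) * (t - a))"])
  have \<delta>: "\<delta> \<ge> 0" using pq[of a] assms(2) by force
  define E where "E t = \<delta> * b ^ n * exp ((K + 1) * (t - a))" for t
  fix t assume t: "t \<in> {a<..<b}"
  have c\<eta>: "(\<eta> has_real_derivative prufer_field n q t (\<eta> t)) (at t)"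
    using \<eta> t by (auto simp: prufer_angle_def)
  show "((\<lambda>t. \<eta> t + \<delta> * b ^ n * exp ((K + 1) * (t - a))) has_real_derivative
      prufer_field n q t (\<eta> t) + (K + 1) * E t) (at t)"
    unfolding E_def by (rule derivative_eq_intros refl c\<eta>)+ (simp add: algebra_simps)
  have bn: "0 \<le> b ^ n" using assms by simp
  have E: "E t \<ge> \<delta> * b ^ n"
  proof -
    have "1 \<le> exp ((K + 1) * (t - a))" using K t by simp
    from mult_left_mono[OF this, of "\<delta> * b ^ n"] show ?thesis unfolding E_def using \<delta> bn by simp
  qed
  then have E0: "E t \<ge> 0" using \<delta> bn by (meson mult_nonneg_nonneg order_trans)
  have "prufer_field n p t (\<eta> t + E t) \<le> prufer_field n p t (\<eta> t) + K * E t"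
    using lip[of t "\<eta> t + E t" "\<eta> t"] t E0 by (simp add: abs_le_iff)
  also have "prufer_field n p t (\<eta> t) = prufer_field n q t (\<eta> t) + t ^ n * (p t - q t) * (sin (\<eta> t))\<^sup>2"
    by (simp add: prufer_field_def algebra_simps)
  also have "t ^ n * (p t - q t) * (sin (\<eta> t))\<^sup>2 \<le> b ^ n * \<delta> * 1"
  proof -
    have "t ^ n * (p t - q t) * (sin (\<eta> t))\<^sup>2 \<le> \<bar>t ^ n * (p t - q t) * (sin (\<eta> t))\<^sup>2\<bar>" by simp
    also have "\<dots> \<le> b ^ n * \<delta> * 1"
      unfolding abs_mult using t \<open>0 < a\<close> pq[of t] bn \<delta>
      by (intro mult_mono) (auto intro!: power_mono simp: power_abs abs_square_le_1)
    finally show ?thesis .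
  qed
  finally show "prufer_field n p t (\<eta> t + \<delta> * b ^ n * exp ((K + 1) * (t - a)))
      \<le> prufer_field n q t (\<eta> t) + (K + 1) * E t"
    using E unfolding E_def[symmetric] by (simp add: algebra_simps)
next
  show "\<theta> a \<le> \<eta> a + \<delta> * b ^ n * exp ((K + 1) * (a - a))"
  proof -
    have "\<delta> \<ge> 0" using pq[of a] assms(2) by force
    then show ?thesis using init assms(1,2) by simp
  qed
next
  show "continuous_on {a..b} (\<lambda>t. \<eta> t + \<delta> * b ^ n * exp ((K + 1) * (t - a)))"
    using \<eta> by (auto simp: prufer_angle_def intro!: continuous_intros)
next
  fix t x y assume "t \<in> {a..b}"
  then show "\<bar>prufer_field n p t x - prufer_field n p t y\<bar> \<le> K * \<bar>x - y\<bar>" by (rule lip)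
qed (use \<theta> \<open>a \<le> b\<close> in \<open>auto simp: prufer_angle_def\<close>)

section \<open>Negative eigenvalues from zeros of solutions\<close>

text \<open>Shooting from \<^term>\<open>a\<close> with angle 0: a parameter \<open>\<mu>\<close> is an eigenvalue whenever the angle at \<^term>\<open>b\<close> is a
multiple of \<^term>\<open>pi\<close>. Different multiples belong to different parameters because the angle at \<^term>\<open>b\<close> is
a function of \<open>\<mu>\<close>.\<close>
theorem sl_negative_eigenvalues:
  assumes ab: "0 < a" "a < b" and q: "continuous_on {a..b} q"
    and zeros: "\<And>\<phi> \<psi>. sl_solution n q a b \<phi> \<psi> \<Longrightarrow>
      \<exists>Z. Z \<subseteq> {a<..<b} \<and> finite Z \<and> card Z = k \<and> (\<forall>t\<in>Z. \<phi> t = 0)"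
  shows "\<exists>M. finite M \<and> card M = k \<and> M \<subseteq> {..<0} \<and>
    (\<forall>\<mu>\<in>M. \<exists>\<phi> \<psi>. sl_solution n (\<lambda>t. q t + \<mu>) a b \<phi> \<psi> \<and> \<phi> a = 0 \<and> \<phi> b = 0 \<and>
      (\<exists>t\<in>{a<..<b}. \<phi> t \<noteq> 0))"
proof -
  obtain M where "M \<ge> 0" and M: "\<And>t. t \<in> {a..b} \<Longrightarrow> \<bar>q t\<bar> \<le> M"
    using continuous_on_interval_abs_bound[OF q] by blast
  have "\<exists>\<theta>. \<theta> a = 0 \<and> prufer_angle n (\<lambda>t. q t + \<mu>) a b \<theta>" for \<mu>
    using ab by (intro prufer_angle_exists continuous_intros q) auto
  then obtain \<theta> where \<theta>0: "\<And>\<mu>. \<theta> \<mu> a = 0" and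
    \<theta>: "\<And>\<mu>. prufer_angle n (\<lambda>t. q t + \<mu>) a b (\<theta> \<mu>)" by metis
  have cq: "continuous_on {a..b} (\<lambda>t. q t + \<mu>)" for \<mu> by (intro continuous_intros q)
  define K where "K = 1 / a ^ n + b ^ n * (2 * M)"
  have K: "K \<ge> 0" using ab \<open>M \<ge> 0\<close> by (simp add: K_def)
  have lip: "\<bar>prufer_field n (\<lambda>t. q t + \<mu>) t x - prufer_field n (\<lambda>t. q t + \<mu>) t y\<bar> \<le> K * \<bar>x - y\<bar>"
    if "\<mu> \<in> {-M..0}" "t \<in> {a..b}" for \<mu> t x y
    unfolding K_def using M[OF that(2)] that by (intro prufer_field_lipschitz ab) auto
  define D where "D = b ^ n * exp ((K + 1) * (b - a))"
  have D: "D > 0" using ab by (simp add: D_def)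
  have le: "\<theta> \<mu> b \<le> \<theta> \<nu> b + D * \<bar>\<mu> - \<nu>\<bar>" if "\<mu> \<in> {-M..0}" for \<mu> \<nu>
    using prufer_angle_parameter_continuity[OF ab(1) less_imp_le[OF ab(2)] K lip[OF that] \<theta> \<theta>, of \<nu> "\<bar>\<mu> - \<nu>\<bar>"]
    by (simp add: \<theta>0 D_def mult_ac)
  have cont: "continuous_on {-M..0} (\<lambda>\<mu>. \<theta> \<mu> b)"
    unfolding continuous_on_iff
  proof (intro ballI allI impI)
    fix \<mu> e :: real assume \<mu>: "\<mu> \<in> {-M..0}" and e: "e > 0"
    show "\<exists>d>0. \<forall>\<nu>\<in>{-M..0}. dist \<nu> \<mu> < d \<longrightarrow> dist (\<theta> \<nu> b) (\<theta> \<mu> b) < e"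
    proof (intro exI[of _ "e / D"] conjI ballI impI)
      fix \<nu> assume \<nu>: "\<nu> \<in> {-M..0}" "dist \<nu> \<mu> < e / D"
      then have "D * \<bar>\<mu> - \<nu>\<bar> < e" using D by (simp add: dist_real_def field_simps abs_minus_commute)
      then show "dist (\<theta> \<nu> b) (\<theta> \<mu> b) < e"
        using le[OF \<mu>, of \<nu>] le[OF \<nu>(1), of \<mu>] by (simp add: dist_real_def abs_minus_commute)
    qed (use e D in auto)
  qed
  \<comment> \<open>For \<open>\<mu> = - M\<close> the potential is nonpositive, so the constant \<open>pi / 2\<close> is a supersolution.\<close>
  have low: "\<theta> (-M) b \<le> pi / 2"
  proof (rule ode_comparison[where F = "prufer_field n (\<lambda>t. q t + - M)" and K = K and f = "\<theta> (-M)"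
        and f' = "\<lambda>t. prufer_field n (\<lambda>t. q t + - M) t (\<theta> (-M) t)"
        and g = "\<lambda>_. pi / 2" and g' = "\<lambda>_. 0" and a = a and b = b])
    show "continuous_on {a..b} (\<lambda>x. pi / 2)" by (intro continuous_intros)
    fix t assume t: "t \<in> {a<..<b}"
    then show "prufer_field n (\<lambda>t. q t + - M) t (pi / 2) \<le> 0"
      using M[of t] ab by (auto simp: prufer_field_def intro!: mult_nonneg_nonpos)
  next
    fix t x y assume "t \<in> {a..b}"
    then show "\<bar>prufer_field n (\<lambda>t. q t + - M) t x - prufer_field n (\<lambda>t. q t + - M) t y\<bar> \<le> K * \<bar>x - y\<bar>"
      using \<open>M \<ge> 0\<close> by (intro lip) auto
  qed (use \<theta>[of "-M"] \<theta>0[of "-M"] ab in \<open>auto simp: prufer_angle_def\<close>)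
  have high: "real k * pi < \<theta> 0 b"
  proof -
    obtain \<rho> where \<rho>: "\<And>t. \<rho> t > 0"
      "sl_solution n q a b (\<lambda>t. \<rho> t * sin (\<theta> 0 t)) (\<lambda>t. \<rho> t * cos (\<theta> 0 t))"
      using prufer_angle_polar[OF _ _ q, of n "\<theta> 0"] \<theta>[of 0] ab by auto
    from zeros[OF this(2)] obtain Z where Z: "Z \<subseteq> {a<..<b}" "finite Z" "card Z = k"
      "\<forall>t\<in>Z. \<rho> t * sin (\<theta> 0 t) = 0" by blast
    have "\<And>t. t \<in> Z \<Longrightarrow> sin (\<theta> 0 t) = 0" using Z(4) \<rho>(1) by (metis less_irrefl mult_eq_0_iff)
    then show ?thesis
      using prufer_angle_counts_zeros[OF ab q _ _ Z(1,2)] \<theta>[of 0] \<theta>0 Z(3) by simp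
  qed
  have "\<exists>\<mu>\<in>{-M..<0}. \<theta> \<mu> b = real j * pi" if j: "j \<in> {1..k}" for j
  proof -
    have "real j * pi \<le> real k * pi" using j by (intro mult_right_mono) auto
    moreover have "1 * pi \<le> real j * pi" using j by (intro mult_right_mono) auto
    ultimately have "\<theta> (-M) b \<le> real j * pi" "real j * pi \<le> \<theta> 0 b"
      using low high pi_gt_zero by linarith+
    then have "\<exists>\<mu>. - M \<le> \<mu> \<and> \<mu> \<le> 0 \<and> \<theta> \<mu> b = real j * pi"
      using \<open>M \<ge> 0\<close> cont by (intro IVT') auto
    moreover have "\<theta> 0 b \<noteq> real j * pi" using high \<open>real j * pi \<le> real k * pi\<close> by linarith
    ultimately show ?thesis by (metis atLeastLessThan_iff less_le)
  qed
  then obtain \<mu> where \<mu>: "\<And>j. j \<in> {1..k} \<Longrightarrow> \<mu> j \<in> {-M..<0} \<and> \<theta> (\<mu> j) b = real j * pi" by metis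
  have inj: "inj_on \<mu> {1..k}"
  proof (rule inj_onI)
    fix i j assume "i \<in> {1..k}" "j \<in> {1..k}" "\<mu> i = \<mu> j"
    then have "real i * pi = real j * pi" using \<mu> by metis
    then show "i = j" by simp
  qed
  show ?thesis
  proof (intro exI[of _ "\<mu> ` {1..k}"] conjI ballI)
    show "card (\<mu> ` {1..k}) = k" using inj by (simp add: card_image)
    show "\<mu> ` {1..k} \<subseteq> {..<0}" using \<mu> by force
    fix \<nu> assume "\<nu> \<in> \<mu> ` {1..k}"
    then obtain j where j: "j \<in> {1..k}" "\<nu> = \<mu> j" by blast
    have end_val: "\<theta> \<nu> b = real j * pi" using \<mu>[OF j(1)] j(2) by simp
    obtain \<rho> where \<rho>: "\<And>t. \<rho> t > 0"
      "sl_solution n (\<lambda>t. q t + \<nu>) a b (\<lambda>t. \<rho> t * sin (\<theta> \<nu> t)) (\<lambda>t. \<rho> t * cos (\<theta> \<nu> t))"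
      using prufer_angle_polar[OF ab(1) less_imp_le[OF ab(2)] cq \<theta>] by blast
    \<comment> \<open>The angle climbs from 0 to at least \<open>pi\<close> and so passes \<open>pi / 2\<close>.\<close>
    have "\<exists>t\<in>{a<..<b}. sin (\<theta> \<nu> t) \<noteq> 0"
    proof -
      have "continuous_on {a..b} (\<theta> \<nu>)" using \<theta> by (auto simp: prufer_angle_def)
      moreover have "1 * pi \<le> real j * pi" using j by (intro mult_right_mono) auto
      ultimately have "\<exists>t. a \<le> t \<and> t \<le> b \<and> \<theta> \<nu> t = pi / 2"
        using ab \<theta>0[of \<nu>] end_val pi_gt_zero by (intro IVT') auto
      then obtain t where t: "a \<le> t" "t \<le> b" "\<theta> \<nu> t = pi / 2" by blast
      have "t \<noteq> a" using t \<theta>0[of \<nu>] by auto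
      moreover have "t \<noteq> b" using t end_val \<open>1 * pi \<le> real j * pi\<close> pi_gt_zero by auto
      moreover have "sin (\<theta> \<nu> t) \<noteq> 0" unfolding t(3) by simp
      ultimately show ?thesis using t(1,2) by (intro bexI[of _ t]) auto
    qed
    then show "\<exists>\<phi> \<psi>. sl_solution n (\<lambda>t. q t + \<nu>) a b \<phi> \<psi> \<and> \<phi> a = 0 \<and> \<phi> b = 0 \<and>
      (\<exists>t\<in>{a<..<b}. \<phi> t \<noteq> 0)"
      using \<rho> end_val \<theta>0[of \<nu>]
      by (intro exI[of _ "\<lambda>t. \<rho> t * sin (\<theta> \<nu> t)"] exI[of _ "\<lambda>t. \<rho> t * cos (\<theta> \<nu> t)"])
        (auto simp: less_le)
  qed simp
qed

section \<open>Sturm comparison and separation\<close>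

lemma sl_solutionD:
  assumes "sl_solution n q a b \<phi> \<psi>"
  shows "continuous_on {a..b} \<phi>" "continuous_on {a..b} \<psi>"
    "\<And>t. t \<in> {a<..<b} \<Longrightarrow> (\<phi> has_real_derivative \<psi> t / t ^ n) (at t)"
    "\<And>t. t \<in> {a<..<b} \<Longrightarrow> (\<psi> has_real_derivative - (t ^ n * q t * \<phi> t)) (at t)"
  using assms by (auto simp: sl_solution_def)

lemma sl_solution_cmult:
  assumes "sl_solution n q a b \<phi> \<psi>"
  shows "sl_solution n q a b (\<lambda>t. c * \<phi> t) (\<lambda>t. c * \<psi> t)"
proof -
  note D = sl_solutionD[OF assms]
  show ?thesis unfolding sl_solution_def
  proof (intro conjI ballI)
    fix t assume t: "t \<in> {a<..<b}"
    show "((\<lambda>t. c * \<phi> t) has_real_derivative c * \<psi> t / t ^ n) (at t)"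
      using DERIV_cmult[OF D(3)[OF t], of c] by simp
    show "((\<lambda>t. c * \<psi> t) has_real_derivative - (t ^ n * q t * (c * \<phi> t))) (at t)"
      using DERIV_cmult[OF D(4)[OF t], of c] by (simp add: mult_ac)
  qed (intro continuous_intros D)+
qed

lemma sl_solution_subinterval:
  assumes "sl_solution n q a b \<phi> \<psi>" "a \<le> c" "d \<le> b"
  shows "sl_solution n q c d \<phi> \<psi>"
proof -
  have "{c..d} \<subseteq> {a..b}" using assms by auto
  then show ?thesis
    using assms unfolding sl_solution_def by (auto intro: continuous_on_subset)
qed

lemma nonvanishing_on_interval_sign:
  fixes f :: "real \<Rightarrow> real"
  assumes "l < r" "continuous_on {l..r} f" and ne: "\<And>t. t \<in> {l<..<r} \<Longrightarrow> f t \<noteq> 0"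
  obtains \<sigma> where "\<sigma> = 1 \<or> \<sigma> = -1" "\<And>t. t \<in> {l<..<r} \<Longrightarrow> \<sigma> * f t > 0"
proof -
  have same: "f s * f t > 0" if st: "s \<in> {l<..<r}" "t \<in> {l<..<r}" "s \<le> t" for s t
  proof (rule ccontr)
    assume "\<not> f s * f t > 0"
    then have "f s \<le> 0 \<and> 0 \<le> f t \<or> f t \<le> 0 \<and> 0 \<le> f s" by (auto simp: zero_less_mult_iff)
    moreover have c: "continuous_on {s..t} f" by (rule continuous_on_subset[OF assms(2)]) (use st in auto)
    ultimately have "\<exists>x. s \<le> x \<and> x \<le> t \<and> f x = 0"
      using IVT'[of f s 0 t, OF _ _ st(3) c] IVT2'[of f t 0 s, OF _ _ st(3) c] by blast
    then show False using ne st by auto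
  qed
  define c where "c = (l + r) / 2"
  have c: "c \<in> {l<..<r}" using \<open>l < r\<close> by (auto simp: c_def field_simps)
  show ?thesis
  proof (rule that[of "sgn (f c)"])
    show "sgn (f c) = 1 \<or> sgn (f c) = - 1" using ne[OF c] by (auto simp: sgn_if)
    fix t assume t: "t \<in> {l<..<r}"
    have "f c * f t > 0" using same[OF c t] same[OF t c] by (cases "c \<le> t") (auto simp: mult.commute)
    then show "sgn (f c) * f t > 0" by (auto simp: sgn_if zero_less_mult_iff)
  qed
qed

text \<open>The Wronskian is the tool for both comparison results below: it is monotone if the potentials are
ordered and the solutions have a sign, and constant if the potentials agree.\<close>
lemma sl_wronskian_has_derivative:
  assumes "sl_solution n q1 a b u w" "sl_solution n q2 a b \<phi> \<psi>" "t \<in> {a<..<b}" "0 < a"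
  shows "((\<lambda>t. \<psi> t * u t - w t * \<phi> t) has_real_derivative t ^ n * (q1 t - q2 t) * u t * \<phi> t) (at t)"
  by (rule derivative_eq_intros refl sl_solutionD(3,4)[OF assms(1)] sl_solutionD(3,4)[OF assms(2)] assms(3))+
    (use assms in \<open>simp add: field_simps\<close>)

text \<open>Only one-sided information is available at the end points, so the sign of the flux is read off from
monotonicity: a negative flux at \<^term>\<open>l\<close> would make \<^term>\<open>u\<close> decrease from 0.\<close>
lemma positive_solution_flux_at_ends:
  assumes "sl_solution n q l r u w" "0 < l" "l < r" "u l = 0" "u r = 0"
    and pos: "\<And>t. t \<in> {l<..<r} \<Longrightarrow> u t > 0"
  shows "w l \<ge> 0" "w r \<le> 0"
proof -
  note D = sl_solutionD[OF assms(1)]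
  show "w l \<ge> 0"
  proof (rule ccontr)
    assume neg: "\<not> w l \<ge> 0"
    have "\<forall>e>0. \<exists>d>0. \<forall>t\<in>{l..r}. dist t l < d \<longrightarrow> dist (w t) (w l) < e"
      using D(2) \<open>l < r\<close> by (simp add: continuous_on_iff)
    then obtain d where d: "d > 0" "\<And>t. t \<in> {l..r} \<Longrightarrow> dist t l < d \<Longrightarrow> dist (w t) (w l) < - w l"
      using neg by (meson neg_0_less_iff_less not_le)
    define s where "s = min (l + d / 2) ((l + r) / 2)"
    have s: "l < s" "s < r" "s < l + d" using d(1) \<open>l < r\<close> by (auto simp: s_def min_def field_simps)
    have "u s < u l"
    proof (rule DERIV_neg_imp_decreasing_open[OF s(1)])
      show "continuous_on {l..s} u" using s by (intro continuous_on_subset[OF D(1)]) auto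
      fix t assume t: "l < t" "t < s"
      then have "w t < 0" using d(2)[of t] s by (auto simp: dist_real_def)
      then have "w t / t ^ n < 0" using t \<open>0 < l\<close> by (simp add: divide_less_0_iff)
      then show "\<exists>y. (u has_real_derivative y) (at t) \<and> y < 0" using D(3)[of t] t s by auto
    qed
    then show False using pos[of s] s \<open>u l = 0\<close> by simp
  qed
  show "w r \<le> 0"
  proof (rule ccontr)
    assume neg: "\<not> w r \<le> 0"
    have "\<forall>e>0. \<exists>d>0. \<forall>t\<in>{l..r}. dist t r < d \<longrightarrow> dist (w t) (w r) < e"
      using D(2) \<open>l < r\<close> by (simp add: continuous_on_iff)
    then obtain d where d: "d > 0" "\<And>t. t \<in> {l..r} \<Longrightarrow> dist t r < d \<Longrightarrow> dist (w t) (w r) < w r"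
      using neg by (meson neg_0_less_iff_less not_le)
    define s where "s = max (r - d / 2) ((l + r) / 2)"
    have s: "l < s" "s < r" "r - d < s" using d(1) \<open>l < r\<close> by (auto simp: s_def max_def field_simps)
    have "u s < u r"
    proof (rule DERIV_pos_imp_increasing_open[OF s(2)])
      show "continuous_on {s..r} u" using s by (intro continuous_on_subset[OF D(1)]) auto
      fix t assume t: "s < t" "t < r"
      then have "w t > 0" using d(2)[of t] s by (auto simp: dist_real_def)
      then have "w t / t ^ n > 0" using t s \<open>0 < l\<close> by simp
      then show "\<exists>y. (u has_real_derivative y) (at t) \<and> y > 0" using D(3)[of t] t s by auto
    qed
    then show False using pos[of s] s \<open>u r = 0\<close> by simp
  qed
qed

text \<open>If \<open>\<phi>\<close> had no zero, both functions could be taken positive. The Wronskian would then decrease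
strictly, although the signs of the flux of \<^term>\<open>u\<close> make it nonpositive at \<^term>\<open>l\<close> and nonnegative at \<^term>\<open>r\<close>.\<close>
lemma sturm_comparison:
  assumes u: "sl_solution n q1 l r u w" and \<phi>: "sl_solution n q2 l r \<phi> \<psi>"
    and lr: "0 < l" "l < r" "u l = 0" "u r = 0"
    and ne: "\<And>t. t \<in> {l<..<r} \<Longrightarrow> u t \<noteq> 0"
    and q: "\<And>t. t \<in> {l<..<r} \<Longrightarrow> q1 t < q2 t"
  shows "\<exists>t\<in>{l<..<r}. \<phi> t = 0"
proof (rule ccontr)
  assume "\<not> ?thesis"
  then have ne': "\<And>t. t \<in> {l<..<r} \<Longrightarrow> \<phi> t \<noteq> 0" by auto
  obtain \<sigma> where \<sigma>: "\<sigma> = 1 \<or> \<sigma> = -1" "\<And>t. t \<in> {l<..<r} \<Longrightarrow> \<sigma> * u t > 0"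
    using nonvanishing_on_interval_sign[OF lr(2) sl_solutionD(1)[OF u] ne] by blast
  obtain \<tau> where \<tau>: "\<tau> = 1 \<or> \<tau> = -1" "\<And>t. t \<in> {l<..<r} \<Longrightarrow> \<tau> * \<phi> t > 0"
    using nonvanishing_on_interval_sign[OF lr(2) sl_solutionD(1)[OF \<phi>] ne'] by blast
  \<comment> \<open>The functions \<open>U\<close> and \<open>\<Phi>\<close> are \<open>u\<close> and \<open>\<phi>\<close> with signs chosen to make them positive.\<close>
  define U W \<Phi> \<Psi> where defs: "U = (\<lambda>t. \<sigma> * u t)" "W = (\<lambda>t. \<sigma> * w t)"
    "\<Phi> = (\<lambda>t. \<tau> * \<phi> t)" "\<Psi> = (\<lambda>t. \<tau> * \<psi> t)"
  have U: "sl_solution n q1 l r U W" and \<Phi>: "sl_solution n q2 l r \<Phi> \<Psi>"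
    unfolding defs by (intro sl_solution_cmult u \<phi>)+
  have Upos: "U t > 0" and \<Phi>pos: "\<Phi> t > 0" if "t \<in> {l<..<r}" for t
    using \<sigma>(2)[OF that] \<tau>(2)[OF that] by (auto simp: defs)
  have U0: "U l = 0" "U r = 0" using lr by (auto simp: defs)
  have W: "W l \<ge> 0" "W r \<le> 0" using positive_solution_flux_at_ends[OF U lr(1,2) U0 Upos] by auto
  have "\<Phi> t \<ge> 0" if "t \<in> {l..r}" for t
  proof (rule continuous_ge_on_closure[of "{l<..<r}" \<Phi>])
    show "continuous_on (closure {l<..<r}) \<Phi>" using sl_solutionD(1)[OF \<Phi>] lr by simp
    show "t \<in> closure {l<..<r}" using that lr by simp
  qed (use \<Phi>pos in force)
  then have \<Phi>0: "\<Phi> l \<ge> 0" "\<Phi> r \<ge> 0" using lr by auto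
  have "\<Psi> r * U r - W r * \<Phi> r < \<Psi> l * U l - W l * \<Phi> l"
  proof (rule DERIV_neg_imp_decreasing_open[OF lr(2)])
    show "continuous_on {l..r} (\<lambda>t. \<Psi> t * U t - W t * \<Phi> t)"
      by (intro continuous_intros sl_solutionD(1,2)[OF U] sl_solutionD(1,2)[OF \<Phi>])
    fix t assume "l < t" "t < r"
    then have t: "t \<in> {l<..<r}" by auto
    have "t ^ n * (q1 t - q2 t) * U t * \<Phi> t < 0"
      using t lr(1) q[OF t] Upos[OF t] \<Phi>pos[OF t] by (simp add: mult_less_0_iff zero_less_mult_iff)
    then show "\<exists>y. ((\<lambda>t. \<Psi> t * U t - W t * \<Phi> t) has_real_derivative y) (at t) \<and> y < 0"
      using sl_wronskian_has_derivative[OF U \<Phi> t lr(1)] by blast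
  qed
  moreover have "W r * \<Phi> r \<le> 0" using W \<Phi>0 by (intro mult_nonpos_nonneg)
  moreover have "0 \<le> W l * \<Phi> l" using W \<Phi>0 by (intro mult_nonneg_nonneg)
  ultimately show False using U0 by simp
qed

text \<open>The constant Wronskian gives \<open>z c * \<phi> c = z d * \<phi> d\<close>, hence \<open>\<phi>\<close> vanishes at \<^term>\<open>c\<close> or changes sign.
The interval is half-open so that zeros found on adjacent intervals are different.\<close>
lemma sturm_separation:
  assumes y: "sl_solution n q c d y z" and \<phi>: "sl_solution n q c d \<phi> \<psi>"
    and cd: "0 < c" "c < d" "y c = 0" "y d = 0" and z: "z c * z d < 0"
  shows "\<exists>t\<in>{c..<d}. \<phi> t = 0"
proof (cases "\<phi> c = 0")
  case True
  then show ?thesis using cd by auto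
next
  case False
  have "\<psi> d * y d - z d * \<phi> d = \<psi> c * y c - z c * \<phi> c"
  proof (rule DERIV_isconst_end[OF cd(2)])
    show "continuous_on {c..d} (\<lambda>t. \<psi> t * y t - z t * \<phi> t)"
      by (intro continuous_intros sl_solutionD(1,2)[OF y] sl_solutionD(1,2)[OF \<phi>])
    show "((\<lambda>t. \<psi> t * y t - z t * \<phi> t) has_real_derivative 0) (at t)" if "c < t" "t < d" for t
      using sl_wronskian_has_derivative[OF y \<phi> _ cd(1), of t] that by simp
  qed
  then have eq: "z d * \<phi> d = z c * \<phi> c" using cd by simp
  have "(z d)\<^sup>2 * (\<phi> c * \<phi> d) = (z c * z d) * (\<phi> c)\<^sup>2"
    using eq by (simp add: power2_eq_square)
  also have "\<dots> < 0" using z False by (simp add: mult_less_0_iff)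
  finally have "\<phi> c * \<phi> d < 0" by (simp add: mult_less_0_iff)
  then have "\<phi> c \<le> 0 \<and> 0 \<le> \<phi> d \<or> \<phi> d \<le> 0 \<and> 0 \<le> \<phi> c" and d: "\<phi> d \<noteq> 0"
    by (auto simp: mult_less_0_iff)
  then have "\<exists>x. c \<le> x \<and> x \<le> d \<and> \<phi> x = 0"
    using IVT'[of \<phi> c 0 d] IVT2'[of \<phi> d 0 c] cd(2) sl_solutionD(1)[OF \<phi>] by force
  then show ?thesis using d by (metis atLeastLessThan_iff less_le)
qed

text \<open>For \<open>u c > 0\<close> take the minimum of \<^term>\<open>u\<close> on \<open>{c..d}\<close>. It is negative: otherwise \<^term>\<open>u\<close> would be
nonnegative and touch 0 at \<^term>\<open>s\<close> with vanishing flux, and since the flux decreases where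
\<open>u \<ge> 0\<close>, it would be nonnegative before \<^term>\<open>s\<close>, so that \<open>u c \<le> u s = 0\<close>.\<close>
lemma sl_solution_opposite_critical_point:
  assumes u: "sl_solution n q a b u w" and q: "\<And>t. t \<in> {a<..<b} \<Longrightarrow> q t \<ge> 0"
    and csd: "0 < a" "a < c" "c < s" "s < d" "d < b"
    and c: "u c \<noteq> 0" and s: "u s = 0" and d: "w d = 0"
  shows "\<exists>e\<in>{c<..d}. w e = 0 \<and> u c * u e < 0"
proof -
  define \<sigma> where "\<sigma> = sgn (u c)"
  define U W where defs: "U = (\<lambda>t. \<sigma> * u t)" "W = (\<lambda>t. \<sigma> * w t)"
  have \<sigma>: "\<sigma> \<noteq> 0" and Uc: "U c > 0" using c by (auto simp: \<sigma>_def defs sgn_if)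
  have U: "sl_solution n q a b U W" unfolding defs by (intro sl_solution_cmult u)
  note D = sl_solutionD[OF U]
  have "\<exists>e\<in>{c..d}. \<forall>t\<in>{c..d}. U e \<le> U t"
    using csd by (intro continuous_attains_inf continuous_on_subset[OF D(1)]) auto
  then obtain e where e: "e \<in> {c..d}" "\<And>t. t \<in> {c..d} \<Longrightarrow> U e \<le> U t" by blast
  have crit: "W t = 0" if t: "t \<in> {c<..<d}" and m: "\<And>r. r \<in> {c..d} \<Longrightarrow> U t \<le> U r" for t
  proof -
    have tab: "t \<in> {a<..<b}" using t csd by auto
    have "W t / t ^ n = 0"
    proof (rule DERIV_local_min[OF D(3)[OF tab], of "min (t - c) (d - t)"])
      show "\<forall>y. \<bar>t - y\<bar> < min (t - c) (d - t) \<longrightarrow> U t \<le> U y" by (auto intro!: m)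
    qed (use t in auto)
    then show ?thesis using tab csd by auto
  qed
  have Us: "U s = 0" using s by (simp add: defs)
  have "U e < 0"
  proof (rule ccontr)
    assume "\<not> U e < 0"
    then have nonneg: "U t \<ge> 0" if "t \<in> {c..d}" for t using e(2)[OF that] by simp
    have Ws: "W s = 0" using csd nonneg Us by (intro crit) auto
    have W: "W t \<ge> 0" if t: "t \<in> {c..s}" for t
    proof -
      have "W s \<le> W t"
      proof (rule DERIV_nonpos_imp_nonincreasing[where f = W])
        fix r assume r: "t \<le> r" "r \<le> s"
        then have r': "r \<in> {a<..<b}" using t csd by auto
        have "- (r ^ n * q r * U r) \<le> 0"
          using q[OF r'] nonneg[of r] r r' t csd by simp
        then show "\<exists>y. (W has_real_derivative y) (at r) \<and> y \<le> 0" using D(4)[OF r'] by blast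
      qed (use t in auto)
      then show ?thesis using Ws by simp
    qed
    have "U c \<le> U s"
    proof (rule DERIV_nonneg_imp_nondecreasing[where f = U])
      fix r assume r: "c \<le> r" "r \<le> s"
      then have r': "r \<in> {a<..<b}" using csd by auto
      have "W r / r ^ n \<ge> 0" using W[of r] r r' csd by simp
      then show "\<exists>y. (U has_real_derivative y) (at r) \<and> 0 \<le> y" using D(3)[OF r'] by blast
    qed (use csd in auto)
    then show False using Uc Us by simp
  qed
  then have "e \<noteq> c" using Uc by auto
  have "W e = 0"
  proof (cases "e = d")
    case True
    then show ?thesis using d by (simp add: defs)
  next
    case False
    then show ?thesis using e \<open>e \<noteq> c\<close> by (intro crit) auto
  qed
  moreover have "u c * u e < 0"
    using \<open>U e < 0\<close> c by (auto simp: defs \<sigma>_def sgn_if mult_less_0_iff split: if_splits)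
  ultimately show ?thesis using e(1) \<open>e \<noteq> c\<close> \<sigma> by (intro bexI[of _ e]) (auto simp: defs)
qed

section \<open>Zeros forced by the Lane-Emden profile\<close>

text \<open>The nonlinearity is continuously differentiable also at 0, because \<open>p > 1\<close>.\<close>
lemma signed_power_has_derivative:
  assumes "p > 1"
  shows "((\<lambda>s::real. \<bar>s\<bar> powr (p - 1) * s) has_real_derivative p * \<bar>x\<bar> powr (p - 1)) (at x)"
proof -
  consider "x > 0" | "x < 0" | "x = 0" by linarith
  then show ?thesis
  proof cases
    case 1
    have "((\<lambda>s. s powr p) has_real_derivative p * x powr (p - 1)) (at x)"
      using 1 by (auto intro!: derivative_eq_intros)
    then have "((\<lambda>s. \<bar>s\<bar> powr (p - 1) * s) has_real_derivative p * x powr (p - 1)) (at x)"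
      by (rule has_field_derivative_transform_within_open[where S = "{0<..}"])
        (use 1 in \<open>auto simp: powr_diff\<close>)
    then show ?thesis using 1 by simp
  next
    case 2
    have "((\<lambda>s. - ((- s) powr p)) has_real_derivative p * (- x) powr (p - 1)) (at x)"
      using 2 by (auto intro!: derivative_eq_intros)
    then have "((\<lambda>s. \<bar>s\<bar> powr (p - 1) * s) has_real_derivative p * (- x) powr (p - 1)) (at x)"
      by (rule has_field_derivative_transform_within_open[where S = "{..<0}"])
        (use 2 in \<open>auto simp: powr_diff\<close>)
    then show ?thesis using 2 by simp
  next
    case 3
    have "((\<lambda>h::real. \<bar>h\<bar> powr (p - 1)) \<longlongrightarrow> \<bar>0\<bar> powr (p - 1)) (at 0)"
      using assms by (intro tendsto_powr' tendsto_intros) auto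
    then have "((\<lambda>h::real. \<bar>h\<bar> powr (p - 1)) \<longlongrightarrow> 0) (at 0)" by simp
    then have "((\<lambda>h::real. (\<bar>0 + h\<bar> powr (p - 1) * (0 + h) - \<bar>0\<bar> powr (p - 1) * 0) / h) \<longlongrightarrow> 0) (at 0)"
      by (rule Lim_transform_eventually) (auto simp: eventually_at_filter)
    then show ?thesis using 3 by (simp add: DERIV_def)
  qed
qed

text \<open>The function \<open>w / t^(n + 1) = u' / t\<close> is the radial factor of the partial derivatives
\<open>(u' / t) * (x \<bullet> d)\<close> of the solution, which satisfy the linearised equation. The second component is
\<open>t^(n + 2)\<close> times its derivative, with \<open>u''\<close> eliminated by the equation for \<^term>\<open>u\<close>; at a critical point of
\<^term>\<open>u\<close> its sign is opposite to that of \<^term>\<open>u\<close>.\<close>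
lemma lane_emden_derivative_solution:
  assumes "p > 1" "0 < a" and u: "sl_solution n (\<lambda>t. \<bar>u t\<bar> powr (p - 1)) a b u w"
  shows "sl_solution (n + 2) (\<lambda>t. p * \<bar>u t\<bar> powr (p - 1)) a b
    (\<lambda>t. w t / t ^ (n + 1))
    (\<lambda>t. - (real (n + 1) * w t) - t ^ (n + 1) * (\<bar>u t\<bar> powr (p - 1) * u t))"
  unfolding sl_solution_def
proof (intro conjI ballI)
  note D = sl_solutionD[OF u]
  show "continuous_on {a..b} (\<lambda>t. w t / t ^ (n + 1))"
    using \<open>0 < a\<close> by (intro continuous_intros D) auto
  show "continuous_on {a..b} (\<lambda>t. - (real (n + 1) * w t) - t ^ (n + 1) * (\<bar>u t\<bar> powr (p - 1) * u t))"
    using \<open>p > 1\<close> by (intro continuous_intros continuous_on_powr' D) auto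
  fix t assume t: "t \<in> {a<..<b}"
  then have t0: "t > 0" using \<open>0 < a\<close> by auto
  define f where "f = \<bar>u t\<bar> powr (p - 1)"
  have w: "(w has_real_derivative - (t ^ n * f * u t)) (at t)" using D(4)[OF t] by (simp add: f_def)
  show "((\<lambda>t. w t / t ^ (n + 1)) has_real_derivative
      (- (real (n + 1) * w t) - t ^ (n + 1) * (\<bar>u t\<bar> powr (p - 1) * u t)) / t ^ (n + 2)) (at t)"
    unfolding f_def[symmetric]
    by (rule derivative_eq_intros refl w)+ (use t0 in \<open>simp_all add: field_simps\<close>)
  have fu: "((\<lambda>t. \<bar>u t\<bar> powr (p - 1) * u t) has_real_derivative p * f * (w t / t ^ n)) (at t)"
    using DERIV_chain2[OF signed_power_has_derivative[OF \<open>p > 1\<close>] D(3)[OF t]] by (simp add: f_def)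
  show "((\<lambda>t. - (real (n + 1) * w t) - t ^ (n + 1) * (\<bar>u t\<bar> powr (p - 1) * u t)) has_real_derivative
      - (t ^ (n + 2) * (p * \<bar>u t\<bar> powr (p - 1)) * (w t / t ^ (n + 1)))) (at t)"
    by (rule derivative_eq_intros refl w fu)+ (use t0 in \<open>simp_all add: field_simps flip: f_def\<close>)
qed

lemma nodal_interval_exists:
  fixes u :: "real \<Rightarrow> real"
  assumes u: "continuous_on {a..b} u" and "u a = 0" "u b = 0" and \<rho>: "\<rho> \<in> {a..b}" "u \<rho> \<noteq> 0"
  shows "\<exists>l r. a \<le> l \<and> l < \<rho> \<and> \<rho> < r \<and> r \<le> b \<and> u l = 0 \<and> u r = 0 \<and> (\<forall>t\<in>{l<..<r}. u t \<noteq> 0)"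
proof -
  let ?L = "{t\<in>{a..\<rho>}. u t = 0}" and ?R = "{t\<in>{\<rho>..b}. u t = 0}"
  have "continuous_on {a..\<rho>} u" "continuous_on {\<rho>..b} u"
    using \<rho> by (auto intro: continuous_on_subset[OF u])
  then have cl: "closed ?L" "closed ?R"
    by (auto simp only: intro!: continuous_closed_preimage_constant)
  have ne: "?L \<noteq> {}" "?R \<noteq> {}" using \<rho> assms by auto
  have bL: "bdd_above ?L" by (rule bdd_aboveI[of _ \<rho>]) auto
  have bR: "bdd_below ?R" by (rule bdd_belowI[of _ \<rho>]) auto
  define l r where "l = Sup ?L" and "r = Inf ?R"
  have "l \<in> ?L" unfolding l_def by (rule closed_contains_Sup[OF ne(1) bL cl(1)])
  then have l: "a \<le> l" "l \<le> \<rho>" "u l = 0" by auto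
  have "r \<in> ?R" unfolding r_def by (rule closed_contains_Inf[OF ne(2) bR cl(2)])
  then have r: "\<rho> \<le> r" "r \<le> b" "u r = 0" by auto
  have "u t \<noteq> 0" if t: "t \<in> {l<..<r}" for t
  proof
    assume 0: "u t = 0"
    show False
    proof (cases "t \<le> \<rho>")
      case True
      then have "t \<in> ?L" using t l 0 by simp
      then have "t \<le> l" unfolding l_def using bL by (rule cSup_upper)
      then show False using t by simp
    next
      case False
      then have "t \<in> ?R" using t r 0 by simp
      then have "r \<le> t" unfolding r_def using bR by (rule cInf_lower)
      then show False using t by simp
    qed
  qed
  moreover have "l \<noteq> \<rho>" "r \<noteq> \<rho>" using l r \<rho>(2) by auto
  ultimately show ?thesis using l r by (intro exI[of _ l] exI[of _ r]) auto
qed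

lemma inj_on_if_increasing:
  fixes t :: "nat \<Rightarrow> real"
  assumes "\<And>i. Suc i < m \<Longrightarrow> t i < t (Suc i)"
  shows "inj_on t {..<m}"
proof -
  have "t i < t j" if "i < j" "j < m" for i j
    using that
  proof (induction j)
    case (Suc j)
    then show ?case using assms[of j] by (cases "i = j") auto
  qed simp
  then show ?thesis
    by (intro linorder_inj_onI) (auto, fastforce)
qed

text \<open>One radius in each of \<^term>\<open>m\<close> nodal zones, in increasing order. The zeros of \<^term>\<open>u\<close> between
successive radii keep the nodal intervals around these radii disjoint.\<close>
definition nodal_radii :: "(real \<Rightarrow> real) \<Rightarrow> real \<Rightarrow> real \<Rightarrow> nat \<Rightarrow> (nat \<Rightarrow> real) \<Rightarrow> bool" where
  "nodal_radii u a b m \<rho> \<longleftrightarrow>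
    (\<forall>i<m. \<rho> i \<in> {a<..<b} \<and> u (\<rho> i) \<noteq> 0) \<and>
    (\<forall>i. Suc i < m \<longrightarrow> (\<exists>s. \<rho> i < s \<and> s < \<rho> (Suc i) \<and> u s = 0))"

lemma nodal_intervals_exist:
  assumes u: "continuous_on {a..b} u" "u a = 0" "u b = 0" and \<rho>: "nodal_radii u a b m \<rho>"
  obtains l r s where
    "\<And>i. i < m \<Longrightarrow> a \<le> l i \<and> l i < r i \<and> r i \<le> b \<and> u (l i) = 0 \<and> u (r i) = 0 \<and> (\<forall>t\<in>{l i<..<r i}. u t \<noteq> 0)"
    "\<And>i. Suc i < m \<Longrightarrow> r i \<le> s i \<and> s i \<le> l (Suc i) \<and> u (s i) = 0"
proof -
  have "\<exists>l r. a \<le> l \<and> l < \<rho> i \<and> \<rho> i < r \<and> r \<le> b \<and> u l = 0 \<and> u r = 0 \<and> (\<forall>t\<in>{l<..<r}. u t \<noteq> 0)"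
    if "i < m" for i
    using \<rho> that by (intro nodal_interval_exists u) (auto simp: nodal_radii_def less_imp_le)
  then obtain l r where lr: "\<And>i. i < m \<Longrightarrow> a \<le> l i \<and> l i < \<rho> i \<and> \<rho> i < r i \<and> r i \<le> b \<and>
      u (l i) = 0 \<and> u (r i) = 0 \<and> (\<forall>t\<in>{l i<..<r i}. u t \<noteq> 0)"
    by metis
  obtain s where s: "\<And>i. Suc i < m \<Longrightarrow> \<rho> i < s i \<and> s i < \<rho> (Suc i) \<and> u (s i) = 0"
    using \<rho> unfolding nodal_radii_def by metis
  have "r i \<le> s i \<and> s i \<le> l (Suc i)" if i: "Suc i < m" for i
  proof -
    have "s i \<notin> {l i<..<r i}" "s i \<notin> {l (Suc i)<..<r (Suc i)}"
      using lr[of i] lr[OF i] s[OF i] i by auto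
    then show ?thesis using lr[of i] lr[OF i] s[OF i] i by auto
  qed
  then show ?thesis
    using lr s by (intro that[of l r s]) (meson less_trans)+
qed

text \<open>Sturm comparison with \<^term>\<open>u\<close> on each nodal interval, where \<open>\<bar>u\<bar> powr (p - 1) < p * \<bar>u\<bar> powr (p - 1)\<close>.\<close>
lemma lane_emden_radial_zeros:
  assumes "p > 1" "0 < a"
    and u: "sl_solution n (\<lambda>t. \<bar>u t\<bar> powr (p - 1)) a b u w" "u a = 0" "u b = 0"
    and \<rho>: "nodal_radii u a b m \<rho>"
    and \<phi>: "sl_solution n (\<lambda>t. p * \<bar>u t\<bar> powr (p - 1)) a b \<phi> \<psi>"
  shows "\<exists>Z. Z \<subseteq> {a<..<b} \<and> finite Z \<and> card Z = m \<and> (\<forall>t\<in>Z. \<phi> t = 0)"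
proof -
  obtain l r s where
    lr: "\<And>i. i < m \<Longrightarrow> a \<le> l i \<and> l i < r i \<and> r i \<le> b \<and> u (l i) = 0 \<and> u (r i) = 0 \<and> (\<forall>t\<in>{l i<..<r i}. u t \<noteq> 0)" and
    s: "\<And>i. Suc i < m \<Longrightarrow> r i \<le> s i \<and> s i \<le> l (Suc i) \<and> u (s i) = 0"
    using nodal_intervals_exist[OF sl_solutionD(1)[OF u(1)] u(2,3) \<rho>] by blast
  have "\<exists>t\<in>{l i<..<r i}. \<phi> t = 0" if i: "i < m" for i
  proof (rule sturm_comparison)
    show "sl_solution n (\<lambda>t. \<bar>u t\<bar> powr (p - 1)) (l i) (r i) u w"
      using lr[OF i] by (intro sl_solution_subinterval[OF u(1)]) auto
    show "sl_solution n (\<lambda>t. p * \<bar>u t\<bar> powr (p - 1)) (l i) (r i) \<phi> \<psi>"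
      using lr[OF i] by (intro sl_solution_subinterval[OF \<phi>]) auto
    show "\<bar>u t\<bar> powr (p - 1) < p * \<bar>u t\<bar> powr (p - 1)" if "t \<in> {l i<..<r i}" for t
      using lr[OF i] that \<open>p > 1\<close> by simp
  qed (use lr[OF i] \<open>0 < a\<close> in auto)
  then obtain t where t: "\<And>i. i < m \<Longrightarrow> t i \<in> {l i<..<r i} \<and> \<phi> (t i) = 0" by metis
  have "t i < t (Suc i)" if i: "Suc i < m" for i
    using t[of i] t[OF i] s[OF i] i by auto
  then have "inj_on t {..<m}" by (rule inj_on_if_increasing)
  moreover have "t i \<in> {a<..<b}" if "i < m" for i using t[OF that] lr[OF that] by auto
  ultimately show ?thesis
    using t by (intro exI[of _ "t ` {..<m}"]) (auto simp: card_image)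
qed

text \<open>Rolle's theorem gives critical points \<open>c 0, ..., c (m - 1)\<close> of \<^term>\<open>u\<close> in the nodal intervals. By
\<open>sl_solution_opposite_critical_point\<close>, some critical point in \<open>{c i<..c (i + 1)}\<close> carries the sign opposite
to that of \<open>u (c i)\<close>, so Sturm separation with the solution of \<open>lane_emden_derivative_solution\<close> puts a
zero of \<open>\<phi>\<close> into \<open>{c i..<c (i + 1)}\<close>.\<close>
lemma lane_emden_angular_zeros:
  assumes "p > 1" "0 < a"
    and u: "sl_solution n (\<lambda>t. \<bar>u t\<bar> powr (p - 1)) a b u w" "u a = 0" "u b = 0"
    and \<rho>: "nodal_radii u a b m \<rho>"
    and \<phi>: "sl_solution (n + 2) (\<lambda>t. p * \<bar>u t\<bar> powr (p - 1)) a b \<phi> \<psi>"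
  shows "\<exists>Z. Z \<subseteq> {a<..<b} \<and> finite Z \<and> card Z = m - 1 \<and> (\<forall>t\<in>Z. \<phi> t = 0)"
proof -
  obtain l r s where
    lr: "\<And>i. i < m \<Longrightarrow> a \<le> l i \<and> l i < r i \<and> r i \<le> b \<and> u (l i) = 0 \<and> u (r i) = 0 \<and> (\<forall>t\<in>{l i<..<r i}. u t \<noteq> 0)" and
    s: "\<And>i. Suc i < m \<Longrightarrow> r i \<le> s i \<and> s i \<le> l (Suc i) \<and> u (s i) = 0"
    using nodal_intervals_exist[OF sl_solutionD(1)[OF u(1)] u(2,3) \<rho>] by blast
  note D = sl_solutionD[OF u(1)]
  have "\<exists>c\<in>{l i<..<r i}. w c = 0" if i: "i < m" for i
  proof -
    have "\<exists>z>l i. z < r i \<and> (\<lambda>h. w z / z ^ n * h) = (\<lambda>v. 0)"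
    proof (rule Rolle_deriv[where f = u])
      show "continuous_on {l i..r i} u" using lr[OF i] by (intro continuous_on_subset[OF D(1)]) auto
      show "(u has_derivative (\<lambda>h. w x / x ^ n * h)) (at x)" if "l i < x" "x < r i" for x
        using that lr[OF i] by (intro D(3)[unfolded has_field_derivative_def]) auto
    qed (use lr[OF i] in auto)
    then obtain z where z: "l i < z" "z < r i" "w z / z ^ n = 0" by (metis mult.right_neutral)
    then have "z > 0" using lr[OF i] \<open>0 < a\<close> by auto
    then show ?thesis using z by (intro bexI[of _ z]) auto
  qed
  then obtain c where c: "\<And>i. i < m \<Longrightarrow> c i \<in> {l i<..<r i} \<and> w (c i) = 0" by metis
  have "\<exists>t\<in>{c i..<c (Suc i)}. \<phi> t = 0" if i: "Suc i < m" for i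
  proof -
    have i': "i < m" using i by simp
    have "\<exists>e\<in>{c i<..c (Suc i)}. w e = 0 \<and> u (c i) * u e < 0"
      by (rule sl_solution_opposite_critical_point[OF u(1), of _ "s i"])
        (use lr[OF i'] lr[OF i] s[OF i] c[OF i'] c[OF i] \<open>0 < a\<close> in auto)
    then obtain e where e: "e \<in> {c i<..c (Suc i)}" "w e = 0" "u (c i) * u e < 0" by blast
    have pos: "0 < c i" "0 < e" and in_ab: "a \<le> c i" "e \<le> b"
      using c[OF i'] c[OF i] lr[OF i'] lr[OF i] e(1) \<open>0 < a\<close> by auto
    have "\<exists>t\<in>{c i..<e}. \<phi> t = 0"
    proof (rule sturm_separation)
      show "sl_solution (n + 2) (\<lambda>t. p * \<bar>u t\<bar> powr (p - 1)) (c i) e (\<lambda>t. w t / t ^ (n + 1))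
          (\<lambda>t. - (real (n + 1) * w t) - t ^ (n + 1) * (\<bar>u t\<bar> powr (p - 1) * u t))"
        using lane_emden_derivative_solution[OF \<open>p > 1\<close> \<open>0 < a\<close> u(1)] in_ab by (rule sl_solution_subinterval)
      show "sl_solution (n + 2) (\<lambda>t. p * \<bar>u t\<bar> powr (p - 1)) (c i) e \<phi> \<psi>"
        using \<phi> in_ab by (rule sl_solution_subinterval)
      have "u (c i) \<noteq> 0" "u e \<noteq> 0" using e(3) by auto
      then have "0 < (c i ^ (n + 1) * e ^ (n + 1)) * (\<bar>u (c i)\<bar> powr (p - 1) * \<bar>u e\<bar> powr (p - 1))"
        using pos by simp
      then have "(c i ^ (n + 1) * e ^ (n + 1)) * (\<bar>u (c i)\<bar> powr (p - 1) * \<bar>u e\<bar> powr (p - 1)) * (u (c i) * u e) < 0"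
        using e(3) by (rule mult_pos_neg)
      then show "(- (real (n + 1) * w (c i)) - c i ^ (n + 1) * (\<bar>u (c i)\<bar> powr (p - 1) * u (c i))) *
          (- (real (n + 1) * w e) - e ^ (n + 1) * (\<bar>u e\<bar> powr (p - 1) * u e)) < 0"
        using c[OF i'] e(2) by (simp add: mult_ac)
    qed (use pos e c[OF i'] in auto)
    then show ?thesis using e(1) by auto
  qed
  then obtain t where t: "\<And>i. Suc i < m \<Longrightarrow> t i \<in> {c i..<c (Suc i)} \<and> \<phi> (t i) = 0" by metis
  have "t i < t (Suc i)" if i: "Suc i < m - 1" for i
  proof -
    have "Suc i < m" "Suc (Suc i) < m" using i by auto
    from t[OF this(1)] t[OF this(2)] show ?thesis by auto
  qed
  then have "inj_on t {..<m - 1}" by (rule inj_on_if_increasing)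
  moreover have "t i \<in> {a<..<b}" if "i < m - 1" for i
  proof -
    have "i < m" "Suc i < m" using that by auto
    then show ?thesis using t[of i] c[of i] c[of "Suc i"] lr[of i] lr[of "Suc i"] by auto
  qed
  ultimately show ?thesis
    using t by (intro exI[of _ "t ` {..<m - 1}"]) (auto simp: card_image)
qed

section \<open>Second derivatives of radial functions times affine functions\<close>

lemma linear_functional_basis_sum:
  fixes F :: "'a::euclidean_space \<Rightarrow> real"
  assumes "linear F"
  shows "F h = (\<Sum>i\<in>Basis. F i * (h \<bullet> i))"
proof -
  have "F h = F (\<Sum>i\<in>Basis. (h \<bullet> i) *\<^sub>R i)" by (simp add: euclidean_representation)
  also have "\<dots> = (\<Sum>i\<in>Basis. F i * (h \<bullet> i))"
    using assms by (simp add: linear_sum linear_scale mult.commute)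
  finally show ?thesis .
qed

lemma partial_deriv_eq:
  assumes "(f has_derivative D) (at x)"
  shows "partial_deriv i f x = D i"
proof -
  have "((\<lambda>t. f (x + t *\<^sub>R i)) has_derivative (\<lambda>t. D (t *\<^sub>R i))) (at 0)"
    by (rule has_derivative_compose[where g = f]) (use assms in \<open>auto intro!: derivative_eq_intros\<close>)
  moreover have "(\<lambda>t. D (t *\<^sub>R i)) = (\<lambda>t. D i * t)"
    using has_derivative_linear[OF assms] by (simp add: linear_scale mult.commute)
  ultimately have "((\<lambda>t. f (x + t *\<^sub>R i)) has_real_derivative D i) (at 0)"
    by (simp add: has_field_derivative_def)
  then show ?thesis unfolding partial_deriv_def by (rule DERIV_imp_deriv)
qed

text \<open>It is enough to differentiate the real-valued partial derivatives: the derivative as a map into the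
space of linear functionals is assembled from them by expansion in the basis, and so is its
continuity in the operator norm.\<close>
lemma C2_on_and_laplacian:
  fixes f :: "'a::euclidean_space \<Rightarrow> real"
  assumes S: "open S"
    and f': "\<And>x. x \<in> S \<Longrightarrow> (f has_derivative f' x) (at x)"
    and f'': "\<And>x i. x \<in> S \<Longrightarrow> i \<in> Basis \<Longrightarrow> ((\<lambda>x. f' x i) has_derivative f'' i x) (at x)"
    and cont: "\<And>i j. i \<in> Basis \<Longrightarrow> j \<in> Basis \<Longrightarrow> continuous_on S (\<lambda>x. f'' i x j)"
  shows "C2_on S f" and "x \<in> S \<Longrightarrow> laplacian f x = (\<Sum>i\<in>Basis. f'' i x i)"
proof -
  define B :: "'a \<Rightarrow> 'a \<Rightarrow> 'a \<Rightarrow>\<^sub>L 'a \<Rightarrow>\<^sub>L real"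
    where "B i j = Blinfun (\<lambda>h. (h \<bullet> j) *\<^sub>R blinfun_inner_left i)" for i j
  have B: "blinfun_apply (B i j) h = (h \<bullet> j) *\<^sub>R blinfun_inner_left i" for i j h
    unfolding B_def
    by (subst bounded_linear_Blinfun_apply)
      (auto intro!: bounded_linear_compose[OF bounded_linear_scaleR_left bounded_linear_inner_left])
  define D1 where "D1 x = (\<Sum>i\<in>Basis. f' x i *\<^sub>R blinfun_inner_left i)" for x
  define D2 where "D2 x = (\<Sum>i\<in>Basis. \<Sum>j\<in>Basis. f'' i x j *\<^sub>R B i j)" for x
  have D1: "blinfun_apply (D1 x) = f' x" if "x \<in> S" for x
  proof
    fix h show "blinfun_apply (D1 x) h = f' x h"
      unfolding linear_functional_basis_sum[OF has_derivative_linear[OF f'[OF that]], of h]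
      by (simp add: D1_def blinfun.sum_left blinfun.scaleR_left)
  qed
  have D2: "(D1 has_derivative blinfun_apply (D2 x)) (at x)" if "x \<in> S" for x
  proof -
    have "(D1 has_derivative (\<lambda>h. \<Sum>i\<in>Basis. f'' i x h *\<^sub>R blinfun_inner_left i)) (at x)"
      unfolding D1_def using f''[OF that] by (auto intro!: derivative_eq_intros)
    moreover have "(\<lambda>h. \<Sum>i\<in>Basis. f'' i x h *\<^sub>R blinfun_inner_left i) = blinfun_apply (D2 x)"
    proof
      fix h
      have "f'' i x h = (\<Sum>j\<in>Basis. f'' i x j * (h \<bullet> j))" if "i \<in> Basis" for i
        using has_derivative_linear[OF f''[OF \<open>x \<in> S\<close> that]] by (rule linear_functional_basis_sum)
      then show "(\<Sum>i\<in>Basis. f'' i x h *\<^sub>R blinfun_inner_left i) = blinfun_apply (D2 x) h"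
        by (simp add: D2_def blinfun.sum_left blinfun.scaleR_left B scaleR_sum_left cong: sum.cong)
    qed
    ultimately show ?thesis by simp
  qed
  have "continuous_on S D2" unfolding D2_def using cont by (intro continuous_intros) auto
  then show "C2_on S f"
    unfolding C2_on_def using f' D1 D2 by (intro exI[of _ D1] exI[of _ D2]) auto
  show "laplacian f x = (\<Sum>i\<in>Basis. f'' i x i)" if x: "x \<in> S"
    unfolding laplacian_def
  proof (rule sum.cong)
    fix i :: 'a assume i: "i \<in> Basis"
    have "(partial_deriv i f has_derivative f'' i x) (at x)"
      by (rule has_derivative_transform_within_open[OF f''[OF x i] S x]) (simp add: partial_deriv_eq[OF f'])
    then show "partial_deriv i (partial_deriv i f) x = f'' i x i" by (rule partial_deriv_eq)
  qed simp
qed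

lemma radial_has_derivative:
  fixes x :: "'a::euclidean_space"
  assumes "x \<noteq> 0" "(\<kappa> has_real_derivative norm x * \<kappa>1 (norm x)) (at (norm x))"
  shows "((\<lambda>x. \<kappa> (norm x)) has_derivative (\<lambda>k. \<kappa>1 (norm x) * (x \<bullet> k))) (at x)"
proof -
  have "((\<lambda>x. \<kappa> (norm x)) has_derivative (\<lambda>k. norm x * \<kappa>1 (norm x) * (k \<bullet> sgn x))) (at x)"
    using has_derivative_compose[OF has_derivative_norm[OF assms(1)] assms(2)[unfolded has_field_derivative_def]] .
  moreover have "(\<lambda>k. norm x * \<kappa>1 (norm x) * (k \<bullet> sgn x)) = (\<lambda>k. \<kappa>1 (norm x) * (x \<bullet> k))"
    using assms(1) by (auto simp: sgn_div_norm inner_commute fun_eq_iff field_simps)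
  ultimately show ?thesis by simp
qed

lemma open_annulus: "open (annulus a b :: 'a::euclidean_space set)"
proof -
  have "open (norm -` {a<..<b} :: 'a set)" by (intro open_vimage continuous_intros)
  also have "norm -` {a<..<b} = (annulus a b :: 'a set)" by (auto simp: annulus_def)
  finally show ?thesis .
qed

text \<open>Radial factors are differentiated by \<open>h' / t\<close> rather than \<open>h'\<close>: the gradient of \<open>h (norm x)\<close> is then
\<open>h1 (norm x)\<close> times \<^term>\<open>x\<close>, again a radial function times a polynomial. The affine factor covers the
radial functions (\<open>d = 0\<close>) and the first spherical harmonics (\<open>\<alpha> = 0\<close>) at once.\<close>
lemma radial_times_affine_C2_laplacian:
  fixes d :: "'a::euclidean_space" and h h1 h2 :: "real \<Rightarrow> real"
  assumes "0 \<le> a"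
    and h: "\<And>t. t \<in> {a<..<b} \<Longrightarrow> (h has_real_derivative t * h1 t) (at t)"
    and h1: "\<And>t. t \<in> {a<..<b} \<Longrightarrow> (h1 has_real_derivative t * h2 t) (at t)"
    and h2: "continuous_on {a<..<b} h2"
    and f: "\<And>x. x \<in> annulus a b \<Longrightarrow> f x = h (norm x) * (\<alpha> + x \<bullet> d)"
  shows "C2_on (annulus a b) f"
    and "x \<in> annulus a b \<Longrightarrow> laplacian f x =
      ((norm x)\<^sup>2 * h2 (norm x) + DIM('a) * h1 (norm x)) * (\<alpha> + x \<bullet> d) + 2 * h1 (norm x) * (x \<bullet> d)"
proof -
  let ?S = "annulus a b :: 'a set"
  define f' where "f' = (\<lambda>x k. h1 (norm x) * (x \<bullet> k) * (\<alpha> + x \<bullet> d) + h (norm x) * (k \<bullet> d))"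
  define f'' where "f'' = (\<lambda>i x k. h2 (norm x) * (x \<bullet> k) * (x \<bullet> i) * (\<alpha> + x \<bullet> d) +
    h1 (norm x) * ((k \<bullet> i) * (\<alpha> + x \<bullet> d) + (x \<bullet> i) * (k \<bullet> d) + (x \<bullet> k) * (i \<bullet> d)))"
  have inS: "x \<noteq> 0" "norm x \<in> {a<..<b}" if "x \<in> ?S" for x
    using that \<open>0 \<le> a\<close> by (auto simp: annulus_def)
  have dh: "((\<lambda>x. h (norm x)) has_derivative (\<lambda>k. h1 (norm x) * (x \<bullet> k))) (at x)"
    and dh1: "((\<lambda>x. h1 (norm x)) has_derivative (\<lambda>k. h2 (norm x) * (x \<bullet> k))) (at x)" if "x \<in> ?S" for x
    by (intro radial_has_derivative inS[OF that] h h1)+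
  have 1: "(f has_derivative f' x) (at x)" if x: "x \<in> ?S" for x
  proof (rule has_derivative_transform_within_open[OF _ open_annulus x])
    show "((\<lambda>x. h (norm x) * (\<alpha> + x \<bullet> d)) has_derivative f' x) (at x)"
      unfolding f'_def by (rule derivative_eq_intros refl dh[OF x])+ (simp add: algebra_simps)
  qed (simp add: f)
  have 2: "((\<lambda>x. f' x i) has_derivative f'' i x) (at x)" if x: "x \<in> ?S" for x i
    unfolding f'_def f''_def
    by (rule derivative_eq_intros refl dh[OF x] dh1[OF x])+ (simp add: algebra_simps)
  have h1c: "continuous_on {a<..<b} h1"
    using h1 by (auto intro!: continuous_at_imp_continuous_on DERIV_isCont[OF h1])
  have 3: "continuous_on ?S (\<lambda>x. f'' i x j)" for i j
    unfolding f''_def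
    by (intro continuous_intros continuous_on_compose2[OF h2, of _ norm] continuous_on_compose2[OF h1c, of _ norm])
      (auto simp: annulus_def)
  show "C2_on (annulus a b) f" by (rule C2_on_and_laplacian(1)[OF open_annulus 1 2 3])
  have sum_inner: "(\<Sum>i\<in>Basis. (x \<bullet> i) * (i \<bullet> y)) = x \<bullet> y" for x y :: 'a
    by (subst euclidean_inner) (simp add: inner_commute)
  assume x: "x \<in> ?S"
  have "laplacian f x = (\<Sum>i\<in>Basis. f'' i x i)"
    by (rule C2_on_and_laplacian(2)[OF open_annulus 1 2 3 x])
  also have "\<dots> = (\<Sum>i\<in>Basis. h2 (norm x) * (\<alpha> + x \<bullet> d) * ((x \<bullet> i) * (i \<bullet> x)) +
      h1 (norm x) * (\<alpha> + x \<bullet> d) + 2 * h1 (norm x) * ((x \<bullet> i) * (i \<bullet> d)))"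
    by (rule sum.cong) (auto simp: f''_def inner_commute algebra_simps)
  also have "\<dots> = h2 (norm x) * (\<alpha> + x \<bullet> d) * (x \<bullet> x) + DIM('a) * (h1 (norm x) * (\<alpha> + x \<bullet> d)) +
      2 * h1 (norm x) * (x \<bullet> d)"
    by (simp add: sum.distrib sum_inner flip: sum_distrib_left)
  finally show "laplacian f x =
      ((norm x)\<^sup>2 * h2 (norm x) + DIM('a) * h1 (norm x)) * (\<alpha> + x \<bullet> d) + 2 * h1 (norm x) * (x \<bullet> d)"
    by (simp add: power2_norm_eq_inner algebra_simps)
qed

section \<open>The profile of a radial solution and its nodal zones\<close>

text \<open>Subtracting the integral of \<^term>\<open>k\<close>, which is continuous on the closed interval, leaves a constant.\<close>
lemma extends_to_closed_interval_if_derivative_does: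
  fixes g k :: "real \<Rightarrow> real"
  assumes "a < b" and k: "continuous_on {a..b} k"
    and g: "\<And>t. t \<in> {a<..<b} \<Longrightarrow> (g has_real_derivative k t) (at t)"
  shows "\<exists>G. continuous_on {a..b} G \<and> (\<forall>t\<in>{a<..<b}. G t = g t)"
proof -
  define I where "I t = integral {a..t} k" for t
  define c where "c = (a + b) / 2"
  have c: "c \<in> {a<..<b}" using \<open>a < b\<close> by (auto simp: c_def field_simps)
  have dI: "(I has_real_derivative k t) (at t)" if t: "t \<in> {a<..<b}" for t
  proof -
    have "(I has_real_derivative k t) (at t within {a..b})"
      unfolding I_def using t by (intro integral_has_real_derivative k) auto
    then have "(I has_real_derivative k t) (at t within {a<..<b})"
      by (rule has_field_derivative_subset) auto
    then show ?thesis using t by (simp add: at_within_open[of t "{a<..<b}"])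
  qed
  have cI: "continuous_on {a..b} I"
    unfolding I_def by (intro indefinite_integral_continuous_1 integrable_continuous_interval k)
  have eq: "g t - I t = g c - I c" if t: "t \<in> {a<..<b}" for t
  proof (rule DERIV_isconst3[OF \<open>a < b\<close> t c])
    fix s assume s: "s \<in> {a<..<b}"
    show "((\<lambda>t. g t - I t) has_real_derivative 0) (at s)"
      using DERIV_diff[OF g[OF s] dI[OF s]] by simp
  qed
  show ?thesis
  proof (intro exI[of _ "\<lambda>t. g c - I c + I t"] conjI ballI)
    show "continuous_on {a..b} (\<lambda>t. g c - I c + I t)" by (intro continuous_intros cI)
    show "g c - I c + I t = g t" if "t \<in> {a<..<b}" for t using eq[OF that] by simp
  qed
qed

lemma unit_vector_exists:
  obtains e :: "'a::euclidean_space" where "norm e = 1"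
  using norm_Basis SOME_Basis by blast

text \<open>Restricting \<^term>\<open>v\<close> to a ray gives a profile of class \<open>C\<^sup>2\<close> in the open interval. Nothing is known about
the gradient of \<^term>\<open>v\<close> at the boundary, but the derivative of the flux \<open>t^(N - 1) u'\<close> is a continuous
function of \<^term>\<open>u\<close>, so the flux extends continuously to the closed interval.\<close>
lemma radial_solution_profile:
  fixes v :: "'a::euclidean_space \<Rightarrow> real"
  assumes ab: "0 < a" "a < b" and p: "p > 1"
    and sol: "lane_emden_solution (annulus a b) p v" and rad: "radial_on (annulus a b) v"
  shows "\<exists>u w. (\<forall>x\<in>annulus a b. v x = u (norm x)) \<and> u a = 0 \<and> u b = 0 \<and>
    sl_solution (DIM('a) - 1) (\<lambda>t. \<bar>u t\<bar> powr (p - 1)) a b u w"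
proof -
  let ?A = "annulus a b :: 'a set"
  obtain e :: 'a where e: "norm e = 1" by (rule unit_vector_exists)
  define u where "u t = v (t *\<^sub>R e)" for t
  have ray: "t *\<^sub>R e \<in> ?A" if "t \<in> {a<..<b}" for t
    using that ab e by (auto simp: annulus_def)
  have vu: "v x = u (norm x)" if x: "x \<in> ?A" for x
  proof -
    obtain U where U: "\<And>x. x \<in> ?A \<Longrightarrow> v x = U (norm x)" using rad unfolding radial_on_def by blast
    have "norm x *\<^sub>R e \<in> ?A" using x by (intro ray) (auto simp: annulus_def)
    then show ?thesis using U[OF x] U[of "norm x *\<^sub>R e"] e by (simp add: u_def)
  qed
  have closure: "t *\<^sub>R e \<in> closure ?A" if t: "t \<in> {a..b}" for t
  proof -
    have "(\<lambda>t. t *\<^sub>R e) ` closure {a<..<b} \<subseteq> closure ?A"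
    proof (rule image_closure_subset)
      show "(\<lambda>t. t *\<^sub>R e) ` {a<..<b} \<subseteq> closure ?A" using ray closure_subset[of ?A] by blast
    qed (auto intro!: continuous_intros)
    then show ?thesis using t ab by (auto simp: image_subset_iff)
  qed
  have cu: "continuous_on {a..b} u"
    unfolding u_def
  proof (rule continuous_on_compose2[of "closure ?A" v])
    show "continuous_on (closure ?A) v" using sol by (simp add: lane_emden_solution_def)
    show "continuous_on {a..b} (\<lambda>t. t *\<^sub>R e)" by (intro continuous_intros)
  qed (use closure in blast)
  have bdry: "u t = 0" if "t = a \<or> t = b" for t
  proof -
    have "t *\<^sub>R e \<in> closure ?A" using that ab by (intro closure) auto
    moreover have "t *\<^sub>R e \<notin> ?A" using that ab e by (auto simp: annulus_def)
    ultimately have "t *\<^sub>R e \<in> frontier ?A" by (simp add: frontier_def interior_open open_annulus)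
    moreover have "\<forall>x\<in>frontier ?A. v x = 0" using sol by (simp add: lane_emden_solution_def)
    ultimately show ?thesis by (simp add: u_def)
  qed
  have "C2_on ?A v" using sol by (simp add: lane_emden_solution_def)
  then obtain f' :: "'a \<Rightarrow> 'a \<Rightarrow>\<^sub>L real" and f'' :: "'a \<Rightarrow> 'a \<Rightarrow>\<^sub>L 'a \<Rightarrow>\<^sub>L real" where
    f': "\<forall>x\<in>?A. (v has_derivative blinfun_apply (f' x)) (at x)" and
    f'': "\<forall>x\<in>?A. (f' has_derivative blinfun_apply (f'' x)) (at x)" and
    cf'': "continuous_on ?A f''"
    unfolding C2_on_def by (elim exE conjE)
  define u1 where "u1 t = blinfun_apply (f' (t *\<^sub>R e)) e" for t
  define u2 where "u2 t = blinfun_apply (blinfun_apply (f'' (t *\<^sub>R e)) e) e" for t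
  have ray_deriv: "((\<lambda>t. t *\<^sub>R e) has_derivative (\<lambda>h. h *\<^sub>R e)) (at t)" for t
    by (auto intro!: derivative_eq_intros)
  have du: "(u has_real_derivative u1 t) (at t)" if t: "t \<in> {a<..<b}" for t
  proof -
    have "((\<lambda>t. v (t *\<^sub>R e)) has_derivative (\<lambda>h. blinfun_apply (f' (t *\<^sub>R e)) (h *\<^sub>R e))) (at t)"
      by (rule has_derivative_compose[OF ray_deriv f'[rule_format, OF ray[OF t]]])
    moreover have "(\<lambda>h. blinfun_apply (f' (t *\<^sub>R e)) (h *\<^sub>R e)) = (*) (u1 t)"
      by (auto simp: u1_def blinfun.scaleR_right mult.commute)
    ultimately show ?thesis unfolding has_field_derivative_def u_def by simp
  qed
  have du1: "(u1 has_real_derivative u2 t) (at t)" if t: "t \<in> {a<..<b}" for t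
  proof -
    have "((\<lambda>t. f' (t *\<^sub>R e)) has_derivative (\<lambda>h. blinfun_apply (f'' (t *\<^sub>R e)) (h *\<^sub>R e))) (at t)"
      by (rule has_derivative_compose[OF ray_deriv f''[rule_format, OF ray[OF t]]])
    then have "((\<lambda>t. blinfun_apply (f' (t *\<^sub>R e)) e) has_derivative
        (\<lambda>h. blinfun_apply (blinfun_apply (f'' (t *\<^sub>R e)) (h *\<^sub>R e)) e)) (at t)"
      by (rule bounded_linear.has_derivative[OF blinfun.bounded_linear_left])
    moreover have "(\<lambda>h. blinfun_apply (blinfun_apply (f'' (t *\<^sub>R e)) (h *\<^sub>R e)) e) = (*) (u2 t)"
      by (auto simp: u2_def blinfun.scaleR_right blinfun.scaleR_left mult.commute)
    ultimately show ?thesis unfolding has_field_derivative_def u1_def by simp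
  qed
  have cu1: "continuous_on {a<..<b} u1"
    by (auto intro!: continuous_at_imp_continuous_on DERIV_isCont[OF du1])
  have cu2: "continuous_on {a<..<b} u2"
  proof -
    have "continuous_on {a<..<b} (\<lambda>t. f'' (t *\<^sub>R e))"
      by (rule continuous_on_compose2[OF cf'']) (use ray in \<open>auto intro!: continuous_intros\<close>)
    then show ?thesis unfolding u2_def by (intro continuous_intros)
  qed
  define n where "n = DIM('a) - 1"
  have N: "real DIM('a) = real n + 1" using DIM_positive[where 'a = 'a] by (simp add: n_def)
  have ode: "u2 t = - (real n * u1 t / t) - \<bar>u t\<bar> powr (p - 1) * u t" if t: "t \<in> {a<..<b}" for t
  proof -
    let ?h1 = "\<lambda>t. u1 t / t" and ?h2 = "\<lambda>t. (u2 t - u1 t / t) / t\<^sup>2"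
    \<comment> \<open>A radial function is the case \<open>\<alpha> = 1\<close>, \<open>d = 0\<close> of a radial function times an affine one.\<close>
    have "laplacian v (t *\<^sub>R e) = ((norm (t *\<^sub>R e))\<^sup>2 * ?h2 (norm (t *\<^sub>R e)) + DIM('a) * ?h1 (norm (t *\<^sub>R e))) * (1 + (t *\<^sub>R e) \<bullet> 0)
        + 2 * ?h1 (norm (t *\<^sub>R e)) * ((t *\<^sub>R e) \<bullet> 0)"
    proof (rule radial_times_affine_C2_laplacian(2)[of a b u ?h1 ?h2])
      fix s assume s: "s \<in> {a<..<b}"
      show "(u has_real_derivative s * (u1 s / s)) (at s)" using du[OF s] s ab by simp
      show "(?h1 has_real_derivative s * ((u2 s - u1 s / s) / s\<^sup>2)) (at s)"
        by (rule derivative_eq_intros refl du1[OF s])+ (use s ab in \<open>auto simp: field_simps power2_eq_square\<close>)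
    next
      show "continuous_on {a<..<b} ?h2" using ab by (intro continuous_intros cu1 cu2) auto
    qed (use ab(1) vu ray[OF t] in simp_all)
    also have "norm (t *\<^sub>R e) = t" using t ab e by simp
    also have "t\<^sup>2 * ((u2 t - u1 t / t) / t\<^sup>2) = u2 t - u1 t / t" using t ab by simp
    finally have "laplacian v (t *\<^sub>R e) = u2 t + real n * u1 t / t"
      by (simp add: N algebra_simps add_divide_distrib)
    moreover have "- laplacian v (t *\<^sub>R e) = \<bar>u t\<bar> powr (p - 1) * u t"
    proof -
      have "\<forall>x\<in>?A. - laplacian v x = \<bar>v x\<bar> powr (p - 1) * v x" using sol by (simp add: lane_emden_solution_def)
      from bspec[OF this ray[OF t]] show ?thesis by (simp add: u_def)
    qed
    ultimately show ?thesis by linarith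
  qed
  have dw: "((\<lambda>t. t ^ n * u1 t) has_real_derivative - (t ^ n * \<bar>u t\<bar> powr (p - 1) * u t)) (at t)"
    if t: "t \<in> {a<..<b}" for t
  proof -
    have t0: "t > 0" using t ab by auto
    have "((\<lambda>t. t ^ n * u1 t) has_real_derivative real n * t ^ (n - 1) * u1 t + t ^ n * u2 t) (at t)"
      by (rule derivative_eq_intros refl du1[OF t])+ simp
    also have "real n * t ^ (n - 1) * u1 t + t ^ n * u2 t = - (t ^ n * \<bar>u t\<bar> powr (p - 1) * u t)"
      unfolding ode[OF t] using t0 by (cases n) (auto simp: field_simps)
    finally show ?thesis .
  qed
  have "continuous_on {a..b} (\<lambda>t. - (t ^ n * \<bar>u t\<bar> powr (p - 1) * u t))"
    using p by (intro continuous_intros continuous_on_powr' cu) auto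
  from extends_to_closed_interval_if_derivative_does[OF ab(2) this dw]
  obtain w where w: "continuous_on {a..b} w" "\<And>t. t \<in> {a<..<b} \<Longrightarrow> w t = t ^ n * u1 t" by blast
  have "sl_solution n (\<lambda>t. \<bar>u t\<bar> powr (p - 1)) a b u w"
    unfolding sl_solution_def
  proof (intro conjI ballI cu w(1))
    fix t assume t: "t \<in> {a<..<b}"
    show "(u has_real_derivative w t / t ^ n) (at t)" using du[OF t] w(2)[OF t] t ab by simp
    show "(w has_real_derivative - (t ^ n * \<bar>u t\<bar> powr (p - 1) * u t)) (at t)"
      by (rule has_field_derivative_transform_within_open[OF dw[OF t], of "{a<..<b}"]) (use t w(2) in auto)
  qed
  then show ?thesis using vu bdry unfolding n_def by (intro exI[of _ u] exI[of _ w]) simp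
qed

text \<open>Choose a point in each component and order the points by their norm. If \<^term>\<open>u\<close> has no zero between the
norms of two of them, the closed shell between these norms lies in the nodal set, and it is connected
since \<open>N \<ge> 2\<close>; so the two components coincide. For equal norms the shell is a sphere, which shows
that the norms are distinct.\<close>
lemma nodal_radii_exist:
  fixes v :: "'a::euclidean_space \<Rightarrow> real"
  assumes dim: "DIM('a) \<ge> 2" and rad: "\<forall>x\<in>annulus a b. v x = u (norm x)"
    and m: "m > 0" "has_nodal_zones (annulus a b) v m"
  shows "\<exists>\<rho>. nodal_radii u a b m \<rho>"
proof -
  have vu: "v x = u (norm x)" if "x \<in> annulus a b" for x using rad that by simp
  define V where "V = {x\<in>annulus a b. v x \<noteq> 0}"
  have card: "card (components V) = m" using m(2) by (simp add: has_nodal_zones_def V_def)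
  then have fin: "finite (components V)" using m(1) by (metis card.infinite less_irrefl)
  have "\<exists>x. x \<in> C" if "C \<in> components V" for C using in_components_nonempty[OF that] by auto
  then obtain X where X: "\<And>C. C \<in> components V \<Longrightarrow> X C \<in> C" by metis
  have XV: "X C \<in> V" if "C \<in> components V" for C using X[OF that] in_components_subset[OF that] by blast
  define r where "r C = norm (X C)" for C
  have r: "r C \<in> {a<..<b} \<and> u (r C) \<noteq> 0" if "C \<in> components V" for C
    using XV[OF that] vu[of "X C"] by (auto simp: V_def annulus_def r_def)
  have same: "C = C'" if C: "C \<in> components V" "C' \<in> components V" "r C \<le> r C'"
    and nz: "\<And>t. t \<in> {r C..r C'} \<Longrightarrow> u t \<noteq> 0" for C C'
  proof -
    \<comment> \<open>The differences with 0 match the form of the annuli in \<open>connected_annulus\<close>.\<close>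
    define T where "T = {x::'a. r C \<le> norm (x - 0) \<and> norm (x - 0) \<le> r C'}"
    have T: "connected T" unfolding T_def by (rule connected_annulus(4)[OF dim])
    have TV: "T \<subseteq> V"
      using r[OF C(1)] r[OF C(2)] nz vu by (auto simp: T_def V_def annulus_def)
    have XT: "X C \<in> T" "X C' \<in> T" using C(3) by (auto simp: T_def r_def)
    have "T \<subseteq> C" by (rule components_maximal[OF C(1) T TV]) (use X[OF C(1)] XT in auto)
    then show "C = C'" using components_eq[OF C(1,2)] XT X[OF C(2)] by auto
  qed
  have inj: "inj_on r (components V)"
  proof (rule inj_onI)
    fix C C' assume C: "C \<in> components V" "C' \<in> components V" "r C = r C'"
    show "C = C'" by (rule same[OF C(1,2)]) (use C(3) r[OF C(1)] in auto)
  qed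
  define R where "R = r ` components V"
  define xs where "xs = sorted_list_of_set R"
  have R: "finite R" "card R = m" using fin card inj by (auto simp: R_def card_image)
  have xs: "set xs = R" "length xs = m" "sorted_wrt (<) xs"
    using R strict_sorted_list_of_set[of R] by (auto simp: xs_def)
  have nth: "xs ! i \<in> R" if "i < m" for i using that xs by (metis nth_mem)
  have "\<exists>s. xs ! i < s \<and> s < xs ! Suc i \<and> u s = 0" if i: "Suc i < m" for i
  proof (rule ccontr)
    assume no: "\<not> ?thesis"
    obtain C C' where C: "C \<in> components V" "C' \<in> components V" "xs ! i = r C" "xs ! Suc i = r C'"
      using nth[of i] nth[OF i] i by (auto simp: R_def)
    have less: "xs ! i < xs ! Suc i"
      using xs i by (intro sorted_wrt_nth_less[of "(<)"]) auto
    have "C = C'"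
    proof (rule same[OF C(1,2)])
      fix t assume t: "t \<in> {r C..r C'}"
      show "u t \<noteq> 0"
        using no t r[OF C(1)] r[OF C(2)] C(3,4) by (cases "t = r C \<or> t = r C'") force+
    qed (use less C in auto)
    then show False using less C by simp
  qed
  moreover have "xs ! i \<in> {a<..<b} \<and> u (xs ! i) \<noteq> 0" if "i < m" for i
    using nth[OF that] r by (auto simp: R_def)
  ultimately show ?thesis unfolding nodal_radii_def by (intro exI[of _ "(!) xs"]) blast
qed

section \<open>Eigenfunctions on the annulus and the Morse index\<close>

text \<open>For \<open>h a = h b = 0\<close>, clamping the norm to \<open>{a..b}\<close> is extension by zero outside the annulus.\<close>
definition annular_mode :: "real \<Rightarrow> real \<Rightarrow> (real \<Rightarrow> real) \<Rightarrow> real \<Rightarrow> 'a::euclidean_space \<Rightarrow> ('a \<Rightarrow>\<^sub>C real)" where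
  "annular_mode a b h \<alpha> d = Bcontfun (\<lambda>x. h (max a (min b (norm x))) * (\<alpha> + x \<bullet> d))"

lemma annular_mode_apply:
  assumes "a \<le> b" "continuous_on {a..b} h" "h b = 0"
  shows "apply_bcontfun (annular_mode a b h \<alpha> d) x = h (max a (min b (norm x))) * (\<alpha> + x \<bullet> d)"
proof -
  let ?f = "\<lambda>x. h (max a (min b (norm x))) * (\<alpha> + x \<bullet> d)"
  have "continuous_on UNIV (\<lambda>t. h (max a (min b t)))"
    using clamped_in_bcontfun[OF assms(1,2)] by (simp add: bcontfun_def)
  then have c: "continuous_on UNIV ?f"
    by (intro continuous_intros continuous_on_compose2[of UNIV "\<lambda>t. h (max a (min b t))" _ norm]) auto
  have "bounded (?f ` cball 0 b)"
    by (intro compact_imp_bounded compact_continuous_image continuous_on_subset[OF c]) auto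
  then have "bounded (insert 0 (?f ` cball 0 b))" by simp
  moreover have "range ?f \<subseteq> insert 0 (?f ` cball 0 b)"
  proof
    fix y assume "y \<in> range ?f"
    then obtain x where x: "y = ?f x" by blast
    show "y \<in> insert 0 (?f ` cball 0 b)"
    proof (cases "norm x \<le> b")
      case False
      then show ?thesis using x assms by (simp add: max_absorb2)
    qed (use x in auto)
  qed
  ultimately have "bounded (range ?f)" by (rule bounded_subset)
  with c have "?f \<in> bcontfun" by (simp add: bcontfun_def)
  then show ?thesis by (simp add: annular_mode_def Bcontfun_inverse)
qed

text \<open>Put \<open>h1 = h' / t\<close> and \<open>h2 = h1' / t\<close>. The radial factor of the Laplacian of \<open>h (norm x) * (\<alpha> + x \<bullet> d)\<close> is
\<open>t^2 h2 + N h1\<close> if \<open>d = 0\<close> and \<open>t^2 h2 + (N + 2) h1\<close> if \<open>\<alpha> = 0\<close>, while the equation for \<^term>\<open>h\<close> reads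
\<open>t^2 h2 + (n + 1) h1 = - (q + \<mu>) h\<close>. The two agree in the two cases of the last hypothesis.\<close>
lemma annular_mode_in_eigenspace:
  fixes v :: "'a::euclidean_space \<Rightarrow> real" and d :: 'a
  assumes ab: "0 < a" "a < b"
    and q: "continuous_on {a..b} q" and vq: "\<And>x. x \<in> annulus a b \<Longrightarrow> p * \<bar>v x\<bar> powr (p - 1) = q (norm x)"
    and h: "sl_solution n (\<lambda>t. q t + \<mu>) a b h \<psi>" "h a = 0" "h b = 0"
    and mode: "(d = 0 \<and> n + 1 = DIM('a)) \<or> (\<alpha> = 0 \<and> n = DIM('a) + 1)"
  shows "annular_mode a b h \<alpha> d \<in> eigenspace (annulus a b) p v \<mu>"
proof -
  let ?A = "annulus a b :: 'a set" and ?F = "apply_bcontfun (annular_mode a b h \<alpha> d)"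
  note D = sl_solutionD[OF h(1)]
  have F: "?F x = h (max a (min b (norm x))) * (\<alpha> + x \<bullet> d)" for x
    using ab by (intro annular_mode_apply D h) simp
  have FA: "?F x = h (norm x) * (\<alpha> + x \<bullet> d)" if "x \<in> ?A" for x
    using that by (simp add: F annulus_def)
  define h1 where "h1 t = \<psi> t / t ^ (n + 1)" for t
  define h2 where "h2 t = - ((q t + \<mu>) * h t) / t\<^sup>2 - real (n + 1) * h1 t / t\<^sup>2" for t
  have dh: "(h has_real_derivative t * h1 t) (at t)" if t: "t \<in> {a<..<b}" for t
    using D(3)[OF t] t ab by (simp add: h1_def)
  have dh1: "(h1 has_real_derivative t * h2 t) (at t)" if t: "t \<in> {a<..<b}" for t
    unfolding h1_def h2_def
    by (rule derivative_eq_intros refl D(4)[OF t])+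
      (use t ab in \<open>simp_all add: field_simps power2_eq_square\<close>)
  have ch2: "continuous_on {a<..<b} h2"
    unfolding h2_def h1_def using ab
    by (intro continuous_intros continuous_on_subset[OF D(1)] continuous_on_subset[OF D(2)] continuous_on_subset[OF q]) auto
  note mode_calc = radial_times_affine_C2_laplacian[OF less_imp_le[OF ab(1)] dh dh1 ch2 FA]
  have "- laplacian ?F x - p * \<bar>v x\<bar> powr (p - 1) * ?F x = \<mu> * ?F x" if x: "x \<in> ?A" for x
  proof -
    define t where "t = norm x"
    have t: "t > 0" using x ab by (auto simp: annulus_def t_def)
    have h2t: "t\<^sup>2 * h2 t = - ((q t + \<mu>) * h t) - real (n + 1) * h1 t"
      using t by (simp add: h2_def field_simps)
    have "laplacian ?F x = (t\<^sup>2 * h2 t + DIM('a) * h1 t) * (\<alpha> + x \<bullet> d) + 2 * h1 t * (x \<bullet> d)"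
      unfolding t_def by (rule mode_calc(2)[OF _ _ _ x])
    also have "\<dots> = - ((q t + \<mu>) * h t) * (\<alpha> + x \<bullet> d)"
      using mode
    proof (elim disjE conjE)
      assume "d = 0" "n + 1 = DIM('a)"
      then show ?thesis unfolding h2t by (simp flip: \<open>n + 1 = DIM('a)\<close> add: algebra_simps)
    next
      assume "\<alpha> = 0" "n = DIM('a) + 1"
      then show ?thesis unfolding h2t by (simp add: algebra_simps)
    qed
    finally show ?thesis using FA[OF x] vq[OF x] by (simp add: t_def algebra_simps)
  qed
  moreover have "?F x = 0" if "x \<notin> ?A" for x
  proof -
    have "norm x \<le> a \<or> b \<le> norm x" using that by (auto simp: annulus_def)
    then have "max a (min b (norm x)) = a \<or> max a (min b (norm x)) = b" using ab by auto
    then show ?thesis using h(2,3) by (auto simp: F)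
  qed
  ultimately show ?thesis unfolding eigenspace_def using mode_calc(1) by blast
qed

text \<open>The condition at \<^term>\<open>b\<close> makes the functions of \<open>annular_mode\<close> vanish outside a ball, hence bounded.\<close>
definition nontrivial_profile :: "real \<Rightarrow> real \<Rightarrow> (real \<Rightarrow> real) \<Rightarrow> bool" where
  "nontrivial_profile a b h \<longleftrightarrow> continuous_on {a..b} h \<and> h b = 0 \<and> (\<exists>t\<in>{a<..<b}. h t \<noteq> 0)"

text \<open>The angular modes depend linearly and injectively on the direction \<^term>\<open>d\<close>. They are odd functions, as is
everything in their span, while the radial mode is even and not zero.\<close>
lemma annular_modes_independent:
  fixes h0 h1 :: "real \<Rightarrow> real"
  assumes "0 < a" and h0: "nontrivial_profile a b h0" and h1: "nontrivial_profile a b h1"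
  defines "G \<equiv> annular_mode a b h1 0 :: 'a \<Rightarrow> ('a::euclidean_space \<Rightarrow>\<^sub>C real)"
  shows "independent (G ` Basis)" "card (G ` Basis) = DIM('a)"
    "annular_mode a b h0 1 0 \<notin> span (G ` Basis)" "annular_mode a b h0 1 0 \<noteq> (0 :: 'a \<Rightarrow>\<^sub>C real)"
proof -
  have ab: "a \<le> b" using h0 by (auto simp: nontrivial_profile_def)
  have G: "apply_bcontfun (G d) x = h1 (max a (min b (norm x))) * (x \<bullet> d)" for d x
    unfolding G_def using h1 ab by (simp add: annular_mode_apply nontrivial_profile_def)
  let ?f = "annular_mode a b h0 1 0 :: 'a \<Rightarrow>\<^sub>C real"
  have f: "apply_bcontfun ?f x = h0 (max a (min b (norm x)))" for x :: 'a
    using h0 ab by (simp add: annular_mode_apply nontrivial_profile_def)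
  have lin: "linear G"
    by (rule linearI) (auto intro!: bcontfun_eqI simp: G inner_right_distrib algebra_simps)
  have "inj G"
    unfolding linear_injective_0[OF lin]
  proof (intro allI impI)
    fix d assume d: "G d = 0"
    obtain t where t: "t \<in> {a<..<b}" "h1 t \<noteq> 0" using h1 by (auto simp: nontrivial_profile_def)
    show "d = 0"
    proof (rule ccontr)
      assume "d \<noteq> 0"
      have "apply_bcontfun (G d) ((t / norm d) *\<^sub>R d) = 0" using d by simp
      then have "h1 t * (t * norm d) = 0"
        using \<open>d \<noteq> 0\<close> t \<open>0 < a\<close> by (simp add: G dot_square_norm power2_eq_square)
      then show False using t \<open>d \<noteq> 0\<close> \<open>0 < a\<close> by auto
    qed
  qed
  then have inj: "inj_on G S" for S by (rule inj_on_subset) simp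
  show "independent (G ` Basis)"
    by (rule linear_independent_injective_image[OF lin independent_Basis inj])
  show "card (G ` Basis) = DIM('a)" by (rule card_image[OF inj])
  obtain t where t: "t \<in> {a<..<b}" "h0 t \<noteq> 0" using h0 by (auto simp: nontrivial_profile_def)
  obtain e :: 'a where e: "norm e = 1" using norm_Basis SOME_Basis by blast
  have ft: "apply_bcontfun ?f (t *\<^sub>R e) \<noteq> 0" "apply_bcontfun ?f (- (t *\<^sub>R e)) = apply_bcontfun ?f (t *\<^sub>R e)"
    using t e \<open>0 < a\<close> by (auto simp: f)
  let ?O = "{g :: 'a \<Rightarrow>\<^sub>C real. \<forall>x. apply_bcontfun g (- x) = - apply_bcontfun g x}"
  have "span (G ` Basis) \<subseteq> ?O"
    by (rule span_minimal) (auto simp: G subspace_def)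
  moreover have "?f \<notin> ?O"
  proof
    assume "?f \<in> ?O"
    then have "apply_bcontfun ?f (- (t *\<^sub>R e)) = - apply_bcontfun ?f (t *\<^sub>R e)" by blast
    then show False using ft by linarith
  qed
  ultimately show "?f \<notin> span (G ` Basis)" by blast
  then show "?f \<noteq> 0" using span_zero by metis
qed

lemma edim_ge_card:
  assumes "B \<subseteq> V" "finite B" "independent B"
  shows "enat (card B) \<le> edim V"
  unfolding edim_def using assms by (intro SUP_upper) auto

lemma edim_ge_radial_and_angular_modes:
  fixes V :: "('a::euclidean_space \<Rightarrow>\<^sub>C real) set"
  assumes "0 < a"
    and rad: "R \<Longrightarrow> \<exists>h. nontrivial_profile a b h \<and> annular_mode a b h 1 0 \<in> V"
    and ang: "T \<Longrightarrow> \<exists>h. nontrivial_profile a b h \<and> (\<forall>d. annular_mode a b h 0 d \<in> V)"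
  shows "enat ((if R then 1 else 0) + (if T then DIM('a) else 0)) \<le> edim V"
proof -
  obtain B where B: "B \<subseteq> V" "finite B" "independent B"
    "card B = (if R then 1 else 0) + (if T then DIM('a) else 0)"
  proof (cases T)
    case T: True
    then obtain h1 where h1: "nontrivial_profile a b h1" "\<And>d. annular_mode a b h1 0 d \<in> V" using ang by blast
    let ?G = "annular_mode a b h1 0 ` Basis :: ('a \<Rightarrow>\<^sub>C real) set"
    have G: "?G \<subseteq> V" using h1(2) by blast
    show ?thesis
    proof (cases R)
      case True
      then obtain h0 where h0: "nontrivial_profile a b h0" "annular_mode a b h0 1 0 \<in> V" using rad by blast
      let ?f = "annular_mode a b h0 1 0 :: 'a \<Rightarrow>\<^sub>C real"
      note ind = annular_modes_independent[where 'a = 'a, OF \<open>0 < a\<close> h0(1) h1(1)]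
      have "?f \<notin> ?G" using ind(3) span_superset[of ?G] by blast
      then have "card (insert ?f ?G) = (if R then 1 else 0) + (if T then DIM('a) else 0)"
        using T True ind(2) by simp
      then show ?thesis
        using G h0(2) independent_insertI[OF ind(3,1)] by (intro that[of "insert ?f ?G"]) simp_all
    next
      case False
      note ind = annular_modes_independent[where 'a = 'a, OF \<open>0 < a\<close> h1(1) h1(1)]
      show ?thesis using G T False ind(1,2) by (intro that[of ?G]) simp_all
    qed
  next
    case F: False
    show ?thesis
    proof (cases R)
      case True
      then obtain h0 where h0: "nontrivial_profile a b h0" "annular_mode a b h0 1 0 \<in> V" using rad by blast
      have "annular_mode a b h0 1 0 \<noteq> (0 :: 'a \<Rightarrow>\<^sub>C real)"
        by (rule annular_modes_independent(4)[OF \<open>0 < a\<close> h0(1) h0(1)])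
      then show ?thesis using F True h0(2) by (intro that[of "{annular_mode a b h0 1 0}"]) simp_all
    next
      case False
      then show ?thesis using F by (intro that[of "{}"]) (simp_all add: independent_empty)
    qed
  qed
  show ?thesis using edim_ge_card[OF B(1-3)] unfolding B(4) .
qed

text \<open>An eigenvalue may belong to both sets; summing the contributions over the union counts each set
completely.\<close>
lemma morse_index_ge_count:
  assumes M: "finite M0" "M0 \<subseteq> {..<0}" "finite M1" "M1 \<subseteq> {..<0}"
    and ge: "\<And>\<mu>. \<mu> \<in> M0 \<union> M1 \<Longrightarrow>
      enat ((if \<mu> \<in> M0 then 1 else 0) + (if \<mu> \<in> M1 then N else 0)) \<le> edim (eigenspace A p v \<mu>)"
  shows "enat (card M0 + N * card M1) \<le> morse_index A p v"
proof -
  have "card M0 + N * card M1 = (\<Sum>\<mu>\<in>M0 \<union> M1. (if \<mu> \<in> M0 then 1 else 0) + (if \<mu> \<in> M1 then N else 0))"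
  proof -
    have "(\<Sum>\<mu>\<in>M0 \<union> M1. if \<mu> \<in> M0 then 1 else 0) = card M0"
      using M by (subst sum.inter_restrict[symmetric]) (auto simp: Int_absorb1)
    moreover have "(\<Sum>\<mu>\<in>M0 \<union> M1. if \<mu> \<in> M1 then N else 0) = N * card M1"
      using M by (subst sum.inter_restrict[symmetric]) (auto simp: Int_absorb1)
    ultimately show ?thesis by (simp add: sum.distrib)
  qed
  then have "enat (card M0 + N * card M1) =
      (\<Sum>\<mu>\<in>M0 \<union> M1. enat ((if \<mu> \<in> M0 then 1 else 0) + (if \<mu> \<in> M1 then N else 0)))"
    by (simp only: of_nat_eq_enat[symmetric] of_nat_sum)
  also have "\<dots> \<le> (\<Sum>\<mu>\<in>M0 \<union> M1. edim (eigenspace A p v \<mu>))"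
    by (intro sum_mono ge)
  also have "\<dots> \<le> morse_index A p v"
    unfolding morse_index_def using M by (intro SUP_upper) auto
  finally show ?thesis .
qed

theorem proposition1p4:
  fixes v :: "'a::euclidean_space \<Rightarrow> real" and a b p :: real and m :: nat
  assumes "DIM('a) \<ge> 2"
    and "0 < a" and "a < b"
    and "p > 1"
    and "m > 0"
    and "lane_emden_solution (annulus a b) p v"
    and "radial_on (annulus a b) v"
    and "has_nodal_zones (annulus a b) v m"
  shows "morse_index (annulus a b) p v > enat ((m - 1) * (DIM('a) + 1))"
proof -
  note ab = \<open>0 < a\<close> \<open>a < b\<close> and p = \<open>p > 1\<close>
  define n where "n = DIM('a) - 1"
  have n: "n + 1 = DIM('a)" "n + 2 = DIM('a) + 1" using assms(1) by (auto simp: n_def)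
  from radial_solution_profile[OF ab p assms(6,7)]
  obtain u w where vu: "\<forall>x\<in>annulus a b. v x = u (norm x)" and u0: "u a = 0" "u b = 0"
    and u: "sl_solution n (\<lambda>t. \<bar>u t\<bar> powr (p - 1)) a b u w"
    unfolding n_def by (elim exE conjE)
  from nodal_radii_exist[OF assms(1) vu assms(5,8)]
  obtain \<rho> where \<rho>: "nodal_radii u a b m \<rho>" by (elim exE)
  define q where "q = (\<lambda>t. p * \<bar>u t\<bar> powr (p - 1))"
  have q: "continuous_on {a..b} q"
    unfolding q_def using p by (intro continuous_intros continuous_on_powr' sl_solutionD(1)[OF u]) auto
  have vq: "p * \<bar>v x\<bar> powr (p - 1) = q (norm x)" if "x \<in> annulus a b" for x
    using vu that by (simp add: q_def)
  have "\<exists>M. finite M \<and> card M = m \<and> M \<subseteq> {..<0} \<and>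
    (\<forall>\<mu>\<in>M. \<exists>\<phi> \<psi>. sl_solution n (\<lambda>t. q t + \<mu>) a b \<phi> \<psi> \<and> \<phi> a = 0 \<and> \<phi> b = 0 \<and>
      (\<exists>t\<in>{a<..<b}. \<phi> t \<noteq> 0))"
  proof (rule sl_negative_eigenvalues[OF ab q])
    fix \<phi> \<psi> assume "sl_solution n q a b \<phi> \<psi>"
    then show "\<exists>Z. Z \<subseteq> {a<..<b} \<and> finite Z \<and> card Z = m \<and> (\<forall>t\<in>Z. \<phi> t = 0)"
      unfolding q_def by (rule lane_emden_radial_zeros[OF p ab(1) u u0 \<rho>])
  qed
  then obtain M0 where M0: "finite M0" "card M0 = m" "M0 \<subseteq> {..<0}" and
    e0: "\<forall>\<mu>\<in>M0. \<exists>\<phi> \<psi>. sl_solution n (\<lambda>t. q t + \<mu>) a b \<phi> \<psi> \<and> \<phi> a = 0 \<and> \<phi> b = 0 \<and>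
      (\<exists>t\<in>{a<..<b}. \<phi> t \<noteq> 0)"
    by (elim exE conjE)
  have "\<exists>M. finite M \<and> card M = m - 1 \<and> M \<subseteq> {..<0} \<and>
    (\<forall>\<mu>\<in>M. \<exists>\<phi> \<psi>. sl_solution (n + 2) (\<lambda>t. q t + \<mu>) a b \<phi> \<psi> \<and> \<phi> a = 0 \<and> \<phi> b = 0 \<and>
      (\<exists>t\<in>{a<..<b}. \<phi> t \<noteq> 0))"
  proof (rule sl_negative_eigenvalues[OF ab q])
    fix \<phi> \<psi> assume "sl_solution (n + 2) q a b \<phi> \<psi>"
    then show "\<exists>Z. Z \<subseteq> {a<..<b} \<and> finite Z \<and> card Z = m - 1 \<and> (\<forall>t\<in>Z. \<phi> t = 0)"
      unfolding q_def by (rule lane_emden_angular_zeros[OF p ab(1) u u0 \<rho>])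
  qed
  then obtain M1 where M1: "finite M1" "card M1 = m - 1" "M1 \<subseteq> {..<0}" and
    e1: "\<forall>\<mu>\<in>M1. \<exists>\<phi> \<psi>. sl_solution (n + 2) (\<lambda>t. q t + \<mu>) a b \<phi> \<psi> \<and> \<phi> a = 0 \<and> \<phi> b = 0 \<and>
      (\<exists>t\<in>{a<..<b}. \<phi> t \<noteq> 0)"
    by (elim exE conjE)
  have "enat (card M0 + DIM('a) * card M1) \<le> morse_index (annulus a b) p v"
  proof (rule morse_index_ge_count[OF M0(1,3) M1(1,3)])
    fix \<mu>
    show "enat ((if \<mu> \<in> M0 then 1 else 0) + (if \<mu> \<in> M1 then DIM('a) else 0))
        \<le> edim (eigenspace (annulus a b) p v \<mu>)"
    proof (rule edim_ge_radial_and_angular_modes[OF ab(1)])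
      assume "\<mu> \<in> M0"
      with e0 obtain \<phi> \<psi> where \<phi>: "sl_solution n (\<lambda>t. q t + \<mu>) a b \<phi> \<psi>" "\<phi> a = 0" "\<phi> b = 0"
        "\<exists>t\<in>{a<..<b}. \<phi> t \<noteq> 0" by blast
      show "\<exists>h. nontrivial_profile a b h \<and> annular_mode a b h 1 0 \<in> eigenspace (annulus a b) p v \<mu>"
      proof (intro exI[of _ \<phi>] conjI)
        show "nontrivial_profile a b \<phi>"
          using sl_solutionD(1)[OF \<phi>(1)] \<phi>(3,4) by (simp add: nontrivial_profile_def)
        show "annular_mode a b \<phi> 1 0 \<in> eigenspace (annulus a b) p v \<mu>"
          using n(1) by (intro annular_mode_in_eigenspace[OF ab q vq \<phi>(1-3)]) simp_all
      qed
    next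
      assume "\<mu> \<in> M1"
      with e1 obtain \<phi> \<psi> where \<phi>: "sl_solution (n + 2) (\<lambda>t. q t + \<mu>) a b \<phi> \<psi>" "\<phi> a = 0" "\<phi> b = 0"
        "\<exists>t\<in>{a<..<b}. \<phi> t \<noteq> 0" by blast
      show "\<exists>h. nontrivial_profile a b h \<and> (\<forall>d. annular_mode a b h 0 d \<in> eigenspace (annulus a b) p v \<mu>)"
      proof (intro exI[of _ \<phi>] conjI allI)
        show "nontrivial_profile a b \<phi>"
          using sl_solutionD(1)[OF \<phi>(1)] \<phi>(3,4) by (simp add: nontrivial_profile_def)
        show "annular_mode a b \<phi> 0 d \<in> eigenspace (annulus a b) p v \<mu>" for d
          using n(2) by (intro annular_mode_in_eigenspace[OF ab q vq \<phi>(1-3)]) simp_all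
      qed
    qed
  qed
  moreover have "(m - 1) * (DIM('a) + 1) < card M0 + DIM('a) * card M1"
  proof -
    have "(m - 1) * (DIM('a) + 1) = m - 1 + DIM('a) * (m - 1)" by simp
    then show ?thesis using \<open>m > 0\<close> unfolding M0(2) M1(2) by simp
  qed
  ultimately show ?thesis by (meson enat_ord_simps(2) less_le_trans)
qed
end
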